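(* For every $n\ge1$, $$\dim\big(\mathbf{PQSym}^{*\infty}_n\big)=\sum_{k=1}^n A^{\infty}_{n,k}$$ and this number equals the number of rooted labeled non-planar trees on $[n]$ whose maximal decreasing subtree is a chain.
   Context: Words are finite words on $\mathbb{N}\setminus\{0\}$. A word $u=u_1\dots u_n$ is a parking function if its nondecreasing rearrangement $u'$ satisfies $u'_i\le i$ for all $i$; prime if moreover $u'_i<i$ for $i\ge 2$. Parkization: for $w$ of length $n$ let $d(w)=\min\{i\ge1:\#\{j:w_j\le i\}<i\}$; if $d(w)=n+1$ then $\mathrm{Park}(w)=w$, else $\mathrm{Park}(w)=\mathrm{Park}(w')$ with $w'$ obtained by decreasing by one all letters greater than $d(w)$. $\mathbf{PQSym}^*$ is the span over a field of characteristic $0$ of $\mathbf{G}_u=\sum_{\mathrm{Park}(w)=u}w$ ($u$ parking function), graded by the length of $u$. $\mathrm{BW}$: infinite sequences of columns $(L_i,M_i)$, $L_i$ finite sets of positive integers whose nonempty members form in order a set composition of $[n]$, $M_i$ a prime parking function of length $|L_i|$. With $\|L\|=|L|$ for $L\ne\emptyset$, $\|\emptyset\|=1$, the bijection $\Phi:\mathrm{BW}\to$ words sends $m$ to $w$ with $w_p=(t\text{-th letter of }M_j)+\sum_{q<j}\|L_q\|$ when $p$ is the $t$-th smallest element of $L_j$; words are identified with elements of $\mathrm{BW}$. The $\infty$-action of $\mathfrak{S}_\infty=\langle s_i=(i,i+1)\rangle$ on $\mathrm{BW}$ lets $s_i$ swap columns $i$ and $i+1$ (always); $\mathbf{PQSym}^{*\infty}$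 is the space of elements of $\mathbf{PQSym}^*$ invariant under this action (extended to words linearly), and $\mathbf{PQSym}^{*\infty}_n$ its intersection with the span of the $\mathbf{G}_u$, $u$ of length $n$. $A^{\infty}_{n,k}=\sum\prod_{i=1}^k(|Q_i|-1)^{|Q_i|-1}$, the sum over set partitions $\{Q_1,\dots,Q_k\}$ of $[n]$ into $k$ blocks, with $0^0=1$. For a rooted labeled tree $T$, its maximal decreasing subtree is the maximal subtree containing the root all of whose edges go from a parent to a child with smaller label; it is a chain if it is a path starting at the root. *)

theory Defs
  imports
    Complex_Main
    "HOL-Library.Function_Algebras"
    "HOL-Library.Disjoint_Sets"
    "HOL-Combinatorics.Transposition"
begin

section \<open>Words, parking functions, parkization\<close>

definition is_word :: "nat list \<Rightarrow> bool" where
  "is_word w \<longleftrightarrow> (\<forall>x\<in>set w. 1 \<le> x)"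

text \<open>List positions are counted from 0, so the letter \<open>u'\<^sub>i\<close> is \<open>sort u ! (i - 1)\<close>.\<close>

definition parking :: "nat list \<Rightarrow> bool" where
  "parking u \<longleftrightarrow> is_word u \<and> (\<forall>i\<in>{1..length u}. sort u ! (i - 1) \<le> i)"

definition prime_parking :: "nat list \<Rightarrow> bool" where
  "prime_parking u \<longleftrightarrow> parking u \<and> (\<forall>i\<in>{2..length u}. sort u ! (i - 1) < i)"

definition park_d :: "nat list \<Rightarrow> nat" where
  "park_d w = (LEAST i. 1 \<le> i \<and> card {j. j < length w \<and> w ! j \<le> i} < i)"

lemma park_d_le: "park_d w \<le> length w + 1"
proof -
  have "card {j. j < length w \<and> w ! j \<le> length w + 1} \<le> card {..<length w}"
    by (rule card_mono) auto
  then show ?thesis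
    unfolding park_d_def by (intro Least_le) auto
qed

lemma park_d_card: "card {j. j < length w \<and> w ! j \<le> park_d w} < park_d w"
proof -
  have "card {j. j < length w \<and> w ! j \<le> length w + 1} \<le> card {..<length w}"
    by (rule card_mono) auto
  then have "1 \<le> length w + 1 \<and> card {j. j < length w \<and> w ! j \<le> length w + 1} < length w + 1"
    by auto
  from LeastI[of "\<lambda>i. 1 \<le> i \<and> card {j. j < length w \<and> w ! j \<le> i} < i", OF this]
  show ?thesis unfolding park_d_def by blast
qed

lemma park_step_decreases:
  assumes "park_d w \<noteq> length w + 1"
  shows "sum_list (map (\<lambda>x. if park_d w < x then x - 1 else x) w) < sum_list w"
proof -
  have "park_d w \<le> length w" using assms park_d_le[of w] by simp
  then have lt: "card {j. j < length w \<and> w ! j \<le> park_d w} < length w"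
    using park_d_card[of w] by simp
  have "\<exists>x\<in>set w. park_d w < x"
  proof (rule ccontr)
    assume "\<not> ?thesis"
    then have "{j. j < length w \<and> w ! j \<le> park_d w} = {..<length w}"
      by (auto simp: not_less)
    with lt show False by simp
  qed
  moreover have "\<exists>x\<in>set w. d < x \<Longrightarrow>
      sum_list (map (\<lambda>x. if d < x then x - 1 else x) w) < sum_list w" for d
  proof (induction w)
    case (Cons a w)
    have le: "sum_list (map (\<lambda>x. if d < x then x - 1 else x) w) \<le> sum_list w"
      by (induction w) auto
    show ?case using Cons le by (cases "\<exists>x\<in>set w. d < x") auto
  qed simp
  ultimately show ?thesis by blast
qed

function park :: "nat list \<Rightarrow> nat list" where
  "park w = (if park_d w = length w + 1 then w
             else park (map (\<lambda>x. if park_d w < x then x - 1 else x) w))"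
  by auto
termination
  by (relation "measure sum_list") (auto simp del: sum_list_map_eq_sum_count intro: park_step_decreases)

declare park.simps [simp del]


section \<open>The algebra of parking functions as a space of series\<close>

text \<open>A formal (possibly infinite) linear combination of words is its coefficient function, and
  it vanishes outside \<^const>\<open>is_word\<close>.\<close>

definition scale_series :: "'k::field_char_0 \<Rightarrow> (nat list \<Rightarrow> 'k) \<Rightarrow> nat list \<Rightarrow> 'k" where
  "scale_series c f = (\<lambda>w. c * f w)"

global_interpretation series: vector_space scale_series
  by unfold_locales (auto simp: scale_series_def fun_eq_iff algebra_simps)

definition G :: "nat list \<Rightarrow> nat list \<Rightarrow> 'k::field_char_0" where
  "G u = (\<lambda>w. if is_word w \<and> park w = u then 1 else 0)"

definition PQSym :: "(nat list \<Rightarrow> 'k::field_char_0) set" where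
  "PQSym = series.span {G u | u. parking u}"

definition PQSym_comp :: "nat \<Rightarrow> (nat list \<Rightarrow> 'k::field_char_0) set" where
  "PQSym_comp n = series.span {G u | u. parking u \<and> length u = n}"


section \<open>Biwords and the action of the infinite symmetric group\<close>

text \<open>Columns \<open>(L\<^sub>i, M\<^sub>i)\<close> are indexed from 0.\<close>

type_synonym biword = "nat \<Rightarrow> nat set \<times> nat list"

definition BW :: "biword set" where
  "BW = {m. (\<exists>n. (\<Union>i. fst (m i)) = {1..n}) \<and>
            (\<forall>i j. i \<noteq> j \<longrightarrow> fst (m i) \<inter> fst (m j) = {}) \<and>
            (\<forall>i. prime_parking (snd (m i)) \<and> length (snd (m i)) = card (fst (m i)))}"

definition col_size :: "nat set \<Rightarrow> nat" where
  "col_size L = (if L = {} then 1 else card L)"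

text \<open>If \<open>p\<close> is the \<open>t\<close>-th smallest element of \<open>L\<close>, then \<open>t - 1\<close> elements of \<open>L\<close> are below \<open>p\<close>;
  this is the 0-based list position of the \<open>t\<close>-th letter of \<open>M\<close>.\<close>

definition Phi :: "biword \<Rightarrow> nat list" where
  "Phi m = map (\<lambda>p. let j = (THE j. p \<in> fst (m j))
                    in snd (m j) ! card {x \<in> fst (m j). x < p} + (\<Sum>q<j. col_size (fst (m q))))
               [1..<Suc (card (\<Union>i. fst (m i)))]"

inductive_set S_inf :: "(nat \<Rightarrow> nat) set" where
  id: "id \<in> S_inf"
| step: "\<sigma> \<in> S_inf \<Longrightarrow> transpose i (Suc i) \<circ> \<sigma> \<in> S_inf"

definition col_act :: "(nat \<Rightarrow> nat) \<Rightarrow> biword \<Rightarrow> biword" where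
  "col_act \<sigma> m = m \<circ> inv \<sigma>"

lemma col_act_transpose:
  "col_act (transpose i (Suc i)) m = m(i := m (Suc i), Suc i := m i)"
  by (auto simp: col_act_def fun_eq_iff transpose_def)

definition word_act :: "(nat \<Rightarrow> nat) \<Rightarrow> nat list \<Rightarrow> nat list" where
  "word_act \<sigma> w = Phi (col_act \<sigma> (the_inv_into BW Phi w))"

text \<open>Linear extension to series: the coefficient of \<open>\<sigma> \<cdot> w\<close> in \<open>\<sigma> \<cdot> f\<close> is that of \<open>w\<close> in \<open>f\<close>.\<close>

definition series_act :: "(nat \<Rightarrow> nat) \<Rightarrow> (nat list \<Rightarrow> 'k::field_char_0) \<Rightarrow> nat list \<Rightarrow> 'k" where
  "series_act \<sigma> f = (\<lambda>w. if is_word w then f (word_act (inv \<sigma>) w) else 0)"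

definition PQSym_inf :: "(nat list \<Rightarrow> 'k::field_char_0) set" where
  "PQSym_inf = {f \<in> PQSym. \<forall>\<sigma>\<in>S_inf. series_act \<sigma> f = f}"

definition PQSym_inf_comp :: "nat \<Rightarrow> (nat list \<Rightarrow> 'k::field_char_0) set" where
  "PQSym_inf_comp n = PQSym_inf \<inter> PQSym_comp n"


section \<open>Set partitions\<close>

definition A_inf :: "nat \<Rightarrow> nat \<Rightarrow> nat" where
  "A_inf n k = (\<Sum>P | partition_on {1..n} P \<and> card P = k. \<Prod>Q\<in>P. (card Q - 1) ^ (card Q - 1))"


section \<open>Rooted labeled trees\<close>

text \<open>A rooted tree is given by its root and its set of edges \<open>(parent, child)\<close>.\<close>

definition rooted_tree :: "nat set \<Rightarrow> nat \<Rightarrow> (nat \<times> nat) set \<Rightarrow> bool" where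
  "rooted_tree V r E \<longleftrightarrow>
     r \<in> V \<and> E \<subseteq> V \<times> V \<and> (\<forall>u. (u, r) \<notin> E) \<and>
     (\<forall>v\<in>V - {r}. \<exists>!u. (u, v) \<in> E) \<and> (\<forall>v\<in>V. (r, v) \<in> E\<^sup>*)"

text \<open>Subtrees are given by their vertex sets: a subgraph of a tree that is itself a tree is
  induced.\<close>

definition decreasing_subtree :: "nat \<Rightarrow> (nat \<times> nat) set \<Rightarrow> nat set \<Rightarrow> bool" where
  "decreasing_subtree r E S \<longleftrightarrow>
     rooted_tree S r (E \<inter> S \<times> S) \<and> (\<forall>(u, v) \<in> E \<inter> S \<times> S. v < u)"

definition max_decreasing_subtree ::
    "nat set \<Rightarrow> nat \<Rightarrow> (nat \<times> nat) set \<Rightarrow> nat set \<Rightarrow> bool" where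
  "max_decreasing_subtree V r E S \<longleftrightarrow>
     S \<subseteq> V \<and> decreasing_subtree r E S \<and>
     (\<forall>S'\<subseteq>V. decreasing_subtree r E S' \<and> S \<subseteq> S' \<longrightarrow> S' = S)"

definition chain_from :: "nat \<Rightarrow> (nat \<times> nat) set \<Rightarrow> nat set \<Rightarrow> bool" where
  "chain_from r E S \<longleftrightarrow>
     (\<exists>xs. xs \<noteq> [] \<and> hd xs = r \<and> distinct xs \<and> set xs = S \<and>
           E \<inter> S \<times> S = {(xs ! i, xs ! Suc i) | i. Suc i < length xs})"

definition chain_trees :: "nat \<Rightarrow> (nat \<times> (nat \<times> nat) set) set" where
  "chain_trees n =
     {(r, E). rooted_tree {1..n} r E \<and>
              (\<exists>S. max_decreasing_subtree {1..n} r E S \<and> chain_from r E S)}"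

end

theory Submission
  imports Defs "HOL-Combinatorics.Permutations"
begin

text \<open>
  Permuting columns and deleting empty columns of a biword identify two words exactly when they have
  the same set of nonempty columns, and parkization deletes the empty columns one by one. So the
  indicator series of the sets of nonempty columns form a basis of the invariants, and there is one
  such set for each partition of \<open>[n]\<close> together with a prime parking function on each block.

  Cutting the edges of the decreasing chain of a tree leaves a forest in which every root is smaller
  than its children, and every such forest arises once, by linking its roots in decreasing order.
  This is a partition of \<open>[n]\<close> with such a tree on each block.

  Both structures on a block \<open>V\<close> are counted by \<open>\<Sum>\<^bsub>S\<^esub> F(|S| - 1, |V - S|)\<close>, the sum over the
  nonempty \<open>S \<subseteq> V\<close>, where \<open>F(a, b) = a (a + b)\<^bsup>b - 1\<^esup>\<close> counts the words \<open>u\<close> of length \<open>b\<close> with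
  \<open>u'\<^sub>i < a + i\<close>, as well as the forests with \<open>a\<close> prescribed roots and \<open>b\<close> other vertices: for both,
  removing the letters up to \<open>a\<close>, respectively the roots, gives the recursion
  \<open>F(a, b) = \<Sum>\<^bsub>s\<^esub> (b choose s) a\<^bsup>s\<^esup> F(s, b - s)\<close>. For prime parking functions \<open>S\<close> is the set of
  positions of the letter 1, for trees it is the root with its children. The binomial theorem
  evaluates the sum to \<open>(|V| - 1)\<^bsup>|V| - 1\<^esup>\<close>.
\<close>

section \<open>Abel-type sums\<close>

definition abel_count :: "nat \<Rightarrow> nat \<Rightarrow> nat" where
  "abel_count a b = (if b = 0 then 1 else a * (a + b) ^ (b - 1))"

lemma abel_count_0_right [simp]: "abel_count a 0 = 1"
  by (simp add: abel_count_def)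

lemma abel_count_0_left: "b > 0 \<Longrightarrow> abel_count 0 b = 0"
  by (simp add: abel_count_def)

lemma add_times_abel_count: "(a + b) * abel_count a b = a * (a + b) ^ b"
  by (cases b) (simp_all add: abel_count_def algebra_simps)

lemma sum_index_times_binomial:
  fixes x y :: "'a::comm_semiring_1"
  shows "(\<Sum>s\<le>n. of_nat (s * (n choose s)) * x ^ s * y ^ (n - s)) = of_nat n * x * (x + y) ^ (n - 1)"
proof (cases n)
  case (Suc m)
  have "(\<Sum>s\<le>n. of_nat (s * (n choose s)) * x ^ s * y ^ (n - s))
      = (\<Sum>t\<le>m. of_nat (Suc t * (Suc m choose Suc t)) * x ^ Suc t * y ^ (m - t))"
    unfolding Suc by (subst sum.atMost_Suc_shift) simp
  also have "\<dots> = (\<Sum>t\<le>m. of_nat n * x * (of_nat (m choose t) * x ^ t * y ^ (m - t)))"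
    unfolding Suc_times_binomial by (simp add: Suc mult_ac del: of_nat_Suc mult_Suc)
  finally show ?thesis by (simp add: Suc binomial_ring sum_distrib_left)
qed simp

lemma sum_binomial_times_abel_count:
  "(\<Sum>s\<le>b. (b choose s) * (a ^ s * abel_count s (b - s))) = abel_count a b"
proof (cases "b = 0")
  case False
  have summand: "b * ((b choose s) * (a ^ s * abel_count s (b - s)))
      = s * (b choose s) * a ^ s * b ^ (b - s)" if "s \<le> b" for s
    using add_times_abel_count[of s "b - s"] that by (simp add: mult.left_commute)
  have "b * (\<Sum>s\<le>b. (b choose s) * (a ^ s * abel_count s (b - s)))
      = (\<Sum>s\<le>b. s * (b choose s) * a ^ s * b ^ (b - s))"
    unfolding sum_distrib_left using summand by (intro sum.cong refl) (simp only: atMost_iff)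
  also have "\<dots> = b * abel_count a b"
    using sum_index_times_binomial[of b a b] False by (simp add: abel_count_def)
  finally show ?thesis using False by simp
qed simp

lemma sum_binomial_times_abel_count_pred:
  assumes "n \<ge> 1"
  shows "(\<Sum>s\<le>n. (n choose s) * abel_count (s - 1) (n - s)) = (n - 1) ^ (n - 1)"
proof (cases "n = 1")
  case False
  define N where "N = n - 1"
  have n_eq: "n = Suc N" and "N > 0" using assms False by (auto simp: N_def)
  have summand: "N * ((n choose s) * abel_count (s - 1) (n - s))
      = (n choose s) * ((s - 1) * N ^ (n - s))" if "s \<le> n" for s
  proof (cases s)
    case 0
    then show ?thesis by (simp add: n_eq abel_count_0_left)
  next
    case (Suc t)
    then show ?thesis
      using add_times_abel_count[of t "N - t"] that by (simp add: n_eq mult.left_commute)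
  qed
  have shift: "s * N ^ (n - s) + (if s = 0 then N ^ n else 0)
      = (s - 1) * N ^ (n - s) + N ^ (n - s)" for s
    by (cases s) simp_all
  have "(\<Sum>s\<le>n. (n choose s) * ((s - 1) * N ^ (n - s))) + (\<Sum>s\<le>n. (n choose s) * N ^ (n - s))
      = (\<Sum>s\<le>n. (n choose s) * (s * N ^ (n - s) + (if s = 0 then N ^ n else 0)))"
    unfolding shift by (simp add: sum.distrib distrib_left)
  also have "\<dots> = (\<Sum>s\<le>n. s * (n choose s) * N ^ (n - s)) + (\<Sum>s\<le>n. if s = 0 then N ^ n else 0)"
    unfolding distrib_left sum.distrib by (simp add: mult_ac if_distrib cong: if_cong)
  finally have "(\<Sum>s\<le>n. (n choose s) * ((s - 1) * N ^ (n - s))) = N * N ^ N"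
    using sum_index_times_binomial[of n 1 N] binomial[of 1 N n] by (simp add: n_eq)
  moreover have "N * (\<Sum>s\<le>n. (n choose s) * abel_count (s - 1) (n - s))
      = (\<Sum>s\<le>n. (n choose s) * ((s - 1) * N ^ (n - s)))"
    unfolding sum_distrib_left using summand by (intro sum.cong refl) (simp only: atMost_iff)
  ultimately have "N * (\<Sum>s\<le>n. (n choose s) * abel_count (s - 1) (n - s)) = N * N ^ N"
    by simp
  then show ?thesis unfolding N_def[symmetric] using \<open>N > 0\<close> by simp
qed (simp add: abel_count_0_left)

lemma card_eq_sum_card_fibres:
  assumes "finite A" "finite B" "f ` A \<subseteq> B"
  shows "card A = (\<Sum>b\<in>B. card {a \<in> A. f a = b})"
  using sum_fun_comp[OF assms, of "\<lambda>_. 1 :: nat"] by simp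

lemma sum_Pow_card:
  fixes f :: "nat \<Rightarrow> 'b::semiring_1"
  assumes "finite V"
  shows "(\<Sum>S\<in>Pow V. f (card S)) = (\<Sum>s\<le>card V. of_nat (card V choose s) * f s)"
  using assms sum_fun_comp[of "Pow V" "{..card V}" card f]
  by (auto simp: card_mono n_subsets Pow_def image_subset_iff)

lemma sum_Pow_abel_count:
  assumes "finite V"
  shows "(\<Sum>S\<in>Pow V. a ^ card S * abel_count (card S) (card (V - S))) = abel_count a (card V)"
proof -
  have "(\<Sum>S\<in>Pow V. a ^ card S * abel_count (card S) (card (V - S)))
      = (\<Sum>S\<in>Pow V. a ^ card S * abel_count (card S) (card V - card S))"
    using assms by (intro sum.cong) (auto simp: card_Diff_subset finite_subset)
  then show ?thesis
    using sum_Pow_card[OF assms, of "\<lambda>s. a ^ s * abel_count s (card V - s)"]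
    by (simp add: sum_binomial_times_abel_count)
qed

text \<open>The empty set contributes \<open>abel_count 0 (card V) = 0\<close>.\<close>

lemma sum_Pow_abel_count_pred:
  assumes "finite V" "V \<noteq> {}"
  shows "(\<Sum>S\<in>Pow V. abel_count (card S - 1) (card (V - S))) = (card V - 1) ^ (card V - 1)"
proof -
  have "(\<Sum>S\<in>Pow V. abel_count (card S - 1) (card (V - S)))
      = (\<Sum>S\<in>Pow V. abel_count (card S - 1) (card V - card S))"
    using assms by (intro sum.cong) (auto simp: card_Diff_subset finite_subset)
  then show ?thesis
    using sum_Pow_card[OF assms(1), of "\<lambda>s. abel_count (s - 1) (card V - s)"] assms
      sum_binomial_times_abel_count_pred[of "card V"]
    by (simp add: Suc_le_eq card_gt_0_iff)
qed

section \<open>Set partitions with a structure on each block\<close>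

definition assemblies :: "('a set \<Rightarrow> 'b set) \<Rightarrow> 'a set \<Rightarrow> ('a set \<times> 'b) set set" where
  "assemblies F V = {C. inj_on fst C \<and> partition_on V (fst ` C) \<and> (\<forall>(Q, M)\<in>C. M \<in> F Q)}"

lemma bij_betw_assemblies:
  "bij_betw (\<lambda>(P, g). (\<lambda>Q. (Q, g Q)) ` P) (SIGMA P:{P. partition_on V P}. Pi\<^sub>E P F) (assemblies F V)"
  (is "bij_betw ?graph ?X _")
proof (rule bij_betw_byWitness[where f' = "\<lambda>C. (fst ` C, \<lambda>Q\<in>fst ` C. snd (inv_into C fst Q))"])
  let ?choice = "\<lambda>C. \<lambda>Q\<in>fst ` C. snd (inv_into C fst Q)"
  have "(\<lambda>Q\<in>P. snd (inv_into ((\<lambda>Q. (Q, g Q)) ` P) fst Q)) = g" if "g \<in> Pi\<^sub>E P F" for P g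
  proof (rule extensionalityI)
    fix Q assume "Q \<in> P"
    then have "inv_into ((\<lambda>Q. (Q, g Q)) ` P) fst Q = (Q, g Q)"
      by (intro inv_into_f_eq) (auto simp: inj_on_def)
    then show "(\<lambda>Q\<in>P. snd (inv_into ((\<lambda>Q. (Q, g Q)) ` P) fst Q)) Q = g Q"
      using \<open>Q \<in> P\<close> by simp
  qed (use that in \<open>auto simp: PiE_def\<close>)
  then show "\<forall>x\<in>?X. (\<lambda>C. (fst ` C, ?choice C)) (?graph x) = x"
    by (auto simp: image_image)
  have snd_inv_into: "snd (inv_into C fst Q) = M" if "C \<in> assemblies F V" "(Q, M) \<in> C" for C Q M
    using inv_into_f_f[of fst C "(Q, M)"] that by (simp add: assemblies_def)
  then show "\<forall>C\<in>assemblies F V. ?graph (fst ` C, ?choice C) = C"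
    by (force simp: image_image)
  show "?graph ` ?X \<subseteq> assemblies F V"
    by (auto simp: assemblies_def inj_on_def image_image)
  show "(\<lambda>C. (fst ` C, ?choice C)) ` assemblies F V \<subseteq> ?X"
  proof (rule image_subsetI)
    fix C assume C: "C \<in> assemblies F V"
    then have "?choice C \<in> Pi\<^sub>E (fst ` C) F"
      using snd_inv_into[OF C] by (auto simp: assemblies_def)
    then show "(fst ` C, ?choice C) \<in> ?X" using C by (simp add: assemblies_def)
  qed
qed

lemma
  assumes V: "finite V" and F: "\<And>Q. Q \<subseteq> V \<Longrightarrow> finite (F Q)"
  shows finite_assemblies: "finite (assemblies F V)"
    and card_assemblies: "card (assemblies F V) = (\<Sum>P | partition_on V P. \<Prod>Q\<in>P. card (F Q))"
proof -
  let ?X = "SIGMA P:{P. partition_on V P}. Pi\<^sub>E P F"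
  have finite_partition: "finite P" if "partition_on V P" for P using finite_elements[OF V that] .
  have "finite (Pi\<^sub>E P F)" if "partition_on V P" for P
    using that F by (intro finite_PiE finite_partition) (auto simp: partition_on_def)
  then have finite: "finite {P. partition_on V P}" "\<forall>P\<in>{P. partition_on V P}. finite (Pi\<^sub>E P F)"
    using V by (auto intro: finitely_many_partition_on)
  then have "finite ?X" by (intro finite_SigmaI) auto
  then show "finite (assemblies F V)" using bij_betw_finite[OF bij_betw_assemblies] by blast
  have "card (assemblies F V) = card ?X" using bij_betw_same_card[OF bij_betw_assemblies] by metis
  also have "\<dots> = (\<Sum>P | partition_on V P. card (Pi\<^sub>E P F))" by (rule card_SigmaI[OF finite])
  also have "\<dots> = (\<Sum>P | partition_on V P. \<Prod>Q\<in>P. card (F Q))"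
    by (intro sum.cong) (auto simp: card_PiE finite_partition)
  finally show "card (assemblies F V) = (\<Sum>P | partition_on V P. \<Prod>Q\<in>P. card (F Q))" .
qed

lemma card_partition_on_le:
  assumes "finite V" "partition_on V P"
  shows "card P \<le> card V"
proof -
  have block: "finite Q" "Q \<noteq> {}" if "Q \<in> P" for Q
    using assms that by (auto simp: partition_on_def intro: finite_subset)
  have "card P = (\<Sum>Q\<in>P. 1)" by simp
  also have "\<dots> \<le> (\<Sum>Q\<in>P. card Q)"
    using block by (intro sum_mono) (simp add: Suc_le_eq card_gt_0_iff)
  also have "\<dots> = card V"
    using assms(2) block by (subst card_Union_disjoint[symmetric])
      (auto simp: partition_on_def disjoint_def pairwise_def disjnt_def)
  finally show ?thesis .
qed

lemma sum_A_inf: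
  assumes "n \<ge> 1"
  shows "(\<Sum>k=1..n. A_inf n k) = (\<Sum>P | partition_on {1..n} P. \<Prod>Q\<in>P. (card Q - 1) ^ (card Q - 1))"
proof -
  have "card P \<in> {1..n}" if "partition_on {1..n} P" for P
  proof -
    have "P \<noteq> {}" using that assms by (auto simp: partition_on_def)
    then have "0 < card P" using finite_elements[OF _ that] by (simp add: card_gt_0_iff)
    then show ?thesis using card_partition_on_le[OF _ that] by simp
  qed
  then show ?thesis
    unfolding A_inf_def mem_Collect_eq
    using sum.group[of "{P. partition_on {1..n} P}" "{1..n}" card]
    by (auto simp: finitely_many_partition_on image_subset_iff)
qed

lemma card_assemblies_eq_sum_A_inf:
  assumes "n \<ge> 1" "\<And>Q. finite Q \<Longrightarrow> finite (F Q)"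
    and "\<And>Q. finite Q \<Longrightarrow> Q \<noteq> {} \<Longrightarrow> card (F Q) = (card Q - 1) ^ (card Q - 1)"
  shows "card (assemblies F {1..n}) = (\<Sum>k=1..n. A_inf n k)"
proof -
  have "card (assemblies F {1..n}) = (\<Sum>P | partition_on {1..n} P. \<Prod>Q\<in>P. card (F Q))"
    by (rule card_assemblies) (simp, rule assms(2)[OF finite_subset[OF _ finite_atLeastAtMost]])
  also have "\<dots> = (\<Sum>P | partition_on {1..n} P. \<Prod>Q\<in>P. (card Q - 1) ^ (card Q - 1))"
  proof (intro sum.cong prod.cong refl assms(3))
    fix P Q assume "P \<in> {P. partition_on {1..n} P}" "Q \<in> P"
    then show "finite Q" "Q \<noteq> {}" by (auto simp: partition_on_def intro: finite_subset)
  qed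
  finally show ?thesis by (simp only: sum_A_inf[OF assms(1)])
qed

section \<open>Counting prime parking functions\<close>

text \<open>The condition says that the nondecreasing rearrangement \<open>u'\<^sub>0 \<le> u'\<^sub>1 \<le> \<dots>\<close> of \<open>u\<close> satisfies
  \<open>u'\<^sub>k < x k\<close>.\<close>

definition vector_park_funs :: "(nat \<Rightarrow> nat) \<Rightarrow> 'a set \<Rightarrow> ('a \<Rightarrow> nat) set" where
  "vector_park_funs x V = {u \<in> V \<rightarrow>\<^sub>E UNIV. \<forall>k<card V. k < card {p \<in> V. u p < x k}}"

lemma vector_park_funs_empty: "vector_park_funs x {} = {\<lambda>_. undefined}"
  by (auto simp: vector_park_funs_def)

lemma vector_park_funs_0:
  assumes "finite V" "V \<noteq> {}" "x 0 = 0"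
  shows "vector_park_funs x V = {}"
proof -
  have "0 < card V" using assms by (simp add: card_gt_0_iff)
  then show ?thesis using assms(3) by (auto simp: vector_park_funs_def)
qed

lemma finite_vector_park_funs:
  assumes V: "finite V"
  shows "finite (vector_park_funs x V)"
proof (rule finite_subset)
  let ?last = "x (card V - 1)"
  show "vector_park_funs x V \<subseteq> V \<rightarrow>\<^sub>E {..<?last}"
  proof
    fix u assume u: "u \<in> vector_park_funs x V"
    have "u p < ?last" if "p \<in> V" for p
    proof -
      have "0 < card V" using that V by (auto simp: card_gt_0_iff)
      then have "card V - 1 < card {p \<in> V. u p < ?last}" using u by (simp add: vector_park_funs_def)
      then have "{p \<in> V. u p < ?last} = V" using V by (intro card_seteq) auto
      then show ?thesis using that by blast
    qed
    then show "u \<in> V \<rightarrow>\<^sub>E {..<?last}" using u by (auto simp: vector_park_funs_def PiE_def)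
  qed
qed (use V in \<open>simp add: finite_PiE\<close>)

definition glue_letters :: "'a set \<Rightarrow> nat \<Rightarrow> 'a set \<Rightarrow> ('a \<Rightarrow> nat) \<Rightarrow> ('a \<Rightarrow> nat) \<Rightarrow> 'a \<Rightarrow> nat" where
  "glue_letters V c S g v = (\<lambda>p\<in>V. if p \<in> S then g p else v p + c)"

lemma bij_betw_glue_letters:
  assumes S: "S \<subseteq> V"
  shows "bij_betw (\<lambda>(g, v). glue_letters V c S g v) ((S \<rightarrow>\<^sub>E {..<c}) \<times> ((V - S) \<rightarrow>\<^sub>E UNIV))
    {u \<in> V \<rightarrow>\<^sub>E UNIV. {p \<in> V. u p < c} = S}"
proof (rule bij_betw_byWitness[where f' = "\<lambda>u. (restrict u S, \<lambda>p\<in>V - S. u p - c)"])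
  show "\<forall>x\<in>(S \<rightarrow>\<^sub>E {..<c}) \<times> ((V - S) \<rightarrow>\<^sub>E UNIV). (\<lambda>u. (restrict u S, \<lambda>p\<in>V - S. u p - c))
      ((\<lambda>(g, v). glue_letters V c S g v) x) = x"
    using S by (auto simp: glue_letters_def fun_eq_iff PiE_def extensional_def)
  show "\<forall>u\<in>{u \<in> V \<rightarrow>\<^sub>E UNIV. {p \<in> V. u p < c} = S}. (\<lambda>(g, v). glue_letters V c S g v)
      (restrict u S, \<lambda>p\<in>V - S. u p - c) = u"
    by (auto simp: glue_letters_def fun_eq_iff PiE_def extensional_def)
  show "(\<lambda>(g, v). glue_letters V c S g v) ` ((S \<rightarrow>\<^sub>E {..<c}) \<times> ((V - S) \<rightarrow>\<^sub>E UNIV))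
      \<subseteq> {u \<in> V \<rightarrow>\<^sub>E UNIV. {p \<in> V. u p < c} = S}"
    using S by (auto simp: glue_letters_def PiE_iff split: if_splits)
qed auto

lemma card_glue_letters_less:
  assumes "finite V" "S \<subseteq> V" "g \<in> S \<rightarrow>\<^sub>E {..<c}" "c \<le> j"
  shows "card {p \<in> V. glue_letters V c S g v p < j} = card S + card {p \<in> V - S. v p < j - c}"
proof -
  have "{p \<in> V. glue_letters V c S g v p < j} = S \<union> {p \<in> V - S. v p < j - c}"
    using assms(2-4) by (fastforce simp: glue_letters_def PiE_iff)
  then show ?thesis
    using assms by (simp add: finite_subset card_Un_disjoint disjoint_iff)
qed

lemma glue_letters_vector_park_funs_iff:
  assumes V: "finite V" and S: "S \<subseteq> V" and g: "g \<in> S \<rightarrow>\<^sub>E {..<c}" and v: "v \<in> (V - S) \<rightarrow>\<^sub>E UNIV"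
    and c_le: "\<And>k. k < card V \<Longrightarrow> c \<le> x k"
  shows "glue_letters V c S g v \<in> vector_park_funs x V
    \<longleftrightarrow> v \<in> vector_park_funs (\<lambda>k. x (card S + k) - c) (V - S)"
proof -
  let ?below = "\<lambda>k. card {p \<in> V - S. v p < x k - c}"
  have card_V: "card V = card S + card (V - S)"
    using S V by (metis card_Diff_subset card_mono finite_subset le_add_diff_inverse)
  have "glue_letters V c S g v \<in> vector_park_funs x V \<longleftrightarrow> (\<forall>k<card V. k < card S + ?below k)"
    using card_glue_letters_less[OF V S g] c_le
    by (simp add: vector_park_funs_def) (simp add: glue_letters_def)
  also have "\<dots> \<longleftrightarrow> (\<forall>k<card (V - S). k < ?below (card S + k))"
  proof (intro iffI allI impI)
    show "k < ?below (card S + k)" if "\<forall>k<card V. k < card S + ?below k" "k < card (V - S)" for k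
      using that(1)[rule_format, of "card S + k"] that(2) card_V by simp
    show "k < card S + ?below k" if "\<forall>k<card (V - S). k < ?below (card S + k)" "k < card V" for k
    proof (cases "k < card S")
      case False
      then have "k - card S < card (V - S)" using that(2) card_V by simp
      then have "k - card S < ?below (card S + (k - card S))" using that(1) by blast
      then show ?thesis using False by simp
    qed simp
  qed
  finally show ?thesis using v by (simp add: vector_park_funs_def)
qed

lemma card_vector_park_funs_low_positions:
  assumes V: "finite V" and S: "S \<subseteq> V" and c_le: "\<And>k. k < card V \<Longrightarrow> c \<le> x k"
  shows "card {u \<in> vector_park_funs x V. {p \<in> V. u p < c} = S}
    = c ^ card S * card (vector_park_funs (\<lambda>k. x (card S + k) - c) (V - S))"
proof -
  let ?glue = "\<lambda>(g, v). glue_letters V c S g v"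
  let ?X = "(S \<rightarrow>\<^sub>E {..<c}) \<times> ((V - S) \<rightarrow>\<^sub>E (UNIV :: nat set))"
  let ?rest = "vector_park_funs (\<lambda>k. x (card S + k) - c) (V - S)"
  have domain_eq: "{y \<in> ?X. snd y \<in> ?rest} = (S \<rightarrow>\<^sub>E {..<c}) \<times> ?rest"
    by (auto simp: vector_park_funs_def)
  have codomain_eq: "{u \<in> {u \<in> V \<rightarrow>\<^sub>E UNIV. {p \<in> V. u p < c} = S}. u \<in> vector_park_funs x V}
      = {u \<in> vector_park_funs x V. {p \<in> V. u p < c} = S}"
    by (auto simp: vector_park_funs_def)
  have "bij_betw ?glue {y \<in> ?X. snd y \<in> ?rest}
      {u \<in> {u \<in> V \<rightarrow>\<^sub>E UNIV. {p \<in> V. u p < c} = S}. u \<in> vector_park_funs x V}"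
  proof (rule bij_betw_Collect[OF bij_betw_glue_letters[OF S]])
    fix y assume "y \<in> ?X"
    then show "?glue y \<in> vector_park_funs x V \<longleftrightarrow> snd y \<in> ?rest"
      using glue_letters_vector_park_funs_iff[OF V S _ _ c_le] by (cases y) simp
  qed
  from bij_betw_same_card[OF this]
  have "card {u \<in> vector_park_funs x V. {p \<in> V. u p < c} = S} = card ((S \<rightarrow>\<^sub>E {..<c}) \<times> ?rest)"
    by (simp only: domain_eq codomain_eq)
  also have "\<dots> = c ^ card S * card (vector_park_funs (\<lambda>k. x (card S + k) - c) (V - S))"
    using V S by (simp add: card_cartesian_product card_PiE finite_subset)
  finally show ?thesis .
qed

lemma card_vector_park_funs_rec:
  assumes V: "finite V" and c_le: "\<And>k. k < card V \<Longrightarrow> c \<le> x k"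
  shows "card (vector_park_funs x V)
    = (\<Sum>S\<in>Pow V. c ^ card S * card (vector_park_funs (\<lambda>k. x (card S + k) - c) (V - S)))"
proof -
  have "card (vector_park_funs x V)
      = (\<Sum>S\<in>Pow V. card {u \<in> vector_park_funs x V. {p \<in> V. u p < c} = S})"
    using V by (intro card_eq_sum_card_fibres) (auto simp: finite_vector_park_funs)
  then show ?thesis using card_vector_park_funs_low_positions[OF V _ c_le] by simp
qed

lemma card_vector_park_funs_add:
  assumes "finite V"
  shows "card (vector_park_funs (\<lambda>k. a + k) V) = abel_count a (card V)"
  using assms
proof (induction V arbitrary: a rule: finite_psubset_induct)
  case (psubset V)
  have "card (vector_park_funs (\<lambda>k. card S + k) (V - S)) = abel_count (card S) (card (V - S))"
    if S: "S \<in> Pow V" for S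
  proof (cases "S = {}")
    case True
    then show ?thesis
      using psubset.hyps vector_park_funs_0[of V "\<lambda>k. k"]
      by (cases "V = {}") (simp_all add: vector_park_funs_empty abel_count_0_left card_gt_0_iff)
  next
    case False
    then show ?thesis using S by (intro psubset.IH) auto
  qed
  then show ?case
    using card_vector_park_funs_rec[OF psubset.hyps, of a "\<lambda>k. a + k"]
      sum_Pow_abel_count[OF psubset.hyps, of a]
    by simp
qed

lemma card_vector_park_funs_max:
  assumes V: "finite V" "V \<noteq> {}"
  shows "card (vector_park_funs (max 1) V) = (card V - 1) ^ (card V - 1)"
proof -
  have "card (vector_park_funs (\<lambda>k. max 1 (card S + k) - 1) (V - S))
      = abel_count (card S - 1) (card (V - S))" if S: "S \<in> Pow V" for S
  proof (cases "S = {}")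
    case True
    then show ?thesis using V by (simp add: vector_park_funs_0 abel_count_0_left card_gt_0_iff)
  next
    case False
    then have "0 < card S" using S V by (auto simp: card_gt_0_iff finite_subset)
    then have "(\<lambda>k. max 1 (card S + k) - 1) = (\<lambda>k. (card S - 1) + k)" by auto
    then show ?thesis using V by (simp add: card_vector_park_funs_add)
  qed
  then show ?thesis
    using card_vector_park_funs_rec[OF V(1), of 1 "max 1"] sum_Pow_abel_count_pred[OF V] by simp
qed

definition letters_le :: "nat list \<Rightarrow> nat \<Rightarrow> nat" where
  "letters_le u i = length (filter (\<lambda>x. x \<le> i) u)"

lemma letters_le_conv_card: "letters_le u i = card {j. j < length u \<and> u ! j \<le> i}"
  by (simp add: letters_le_def length_filter_conv_card)

lemma letters_le_le_length: "letters_le u i \<le> length u"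
  by (simp add: letters_le_def)

lemma letters_le_map:
  assumes "distinct xs"
  shows "letters_le (map f xs) i = card {x \<in> set xs. f x \<le> i}"
proof -
  have "letters_le (map f xs) i = length (filter (\<lambda>x. f x \<le> i) xs)"
    by (simp add: letters_le_def filter_map comp_def)
  also have "\<dots> = card (set (filter (\<lambda>x. f x \<le> i) xs))"
    using assms by (intro distinct_card[symmetric]) simp
  finally show ?thesis by simp
qed

lemma letters_le_sort: "letters_le (sort u) i = letters_le u i"
  by (simp add: letters_le_def filter_sort)

lemma sorted_nth_le_iff:
  assumes "sorted v" "k < length v"
  shows "v ! k \<le> i \<longleftrightarrow> k < letters_le v i"
  using assms
proof (induction v arbitrary: k)
  case (Cons a v)
  show ?case
  proof (cases "a \<le> i")
    case True
    then show ?thesis using Cons by (cases k) (auto simp: letters_le_def)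
  next
    case False
    then have "filter (\<lambda>x. x \<le> i) (a # v) = []"
      using Cons.prems(1) by (auto simp: filter_empty_conv)
    moreover have "a \<le> (a # v) ! k" using Cons.prems sorted_nth_mono[of "a # v" 0 k] by simp
    ultimately show ?thesis using False by (auto simp: letters_le_def)
  qed
qed simp

lemma sort_nth_le_iff: "k < length u \<Longrightarrow> sort u ! k \<le> i \<longleftrightarrow> k < letters_le u i"
  using sorted_nth_le_iff[of "sort u" k i] by (simp add: letters_le_sort)

lemma parking_iff: "parking u \<longleftrightarrow> is_word u \<and> (\<forall>i\<in>{1..length u}. i \<le> letters_le u i)"
  unfolding parking_def by (intro conj_cong refl ball_cong) (auto simp: sort_nth_le_iff)

text \<open>In terms of positions counted from 0, the letters of the rearrangement of a prime parking
  function are bounded by \<open>1, 1, 2, 3, \<dots>\<close>.\<close>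

lemma prime_parking_iff:
  "prime_parking u \<longleftrightarrow> is_word u \<and> (\<forall>k<length u. k < letters_le u (max 1 k))"
proof -
  have "prime_parking u \<longleftrightarrow> is_word u \<and> (\<forall>k<length u. sort u ! k \<le> max 1 k)"
  proof (intro iffI conjI allI impI)
    assume u: "prime_parking u"
    then show "is_word u" by (simp add: prime_parking_def parking_def)
    have sort_le: "sort u ! (i - 1) \<le> i" if "i \<in> {1..length u}" for i
      using u that by (simp add: prime_parking_def parking_def)
    have sort_less: "sort u ! (i - 1) < i" if "i \<in> {2..length u}" for i
      using u that by (simp add: prime_parking_def)
    show "sort u ! k \<le> max 1 k" if "k < length u" for k
      using sort_le[of "Suc k"] sort_less[of "Suc k"] that by (cases "k = 0") auto
  next
    assume u: "is_word u \<and> (\<forall>k<length u. sort u ! k \<le> max 1 k)"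
    have bound: "sort u ! (i - 1) \<le> max 1 (i - 1)" if "i \<in> {1..length u}" for i
      using u that by auto
    show "prime_parking u"
      unfolding prime_parking_def parking_def
    proof (intro conjI ballI)
      show "is_word u" using u by simp
      show "sort u ! (i - 1) \<le> i" if "i \<in> {1..length u}" for i
        using bound[OF that] that by (auto simp: max_def split: if_splits)
      show "sort u ! (i - 1) < i" if "i \<in> {2..length u}" for i
        using bound[of i] that by auto
    qed
  qed
  then show ?thesis by (simp add: sort_nth_le_iff)
qed

lemma prime_parking_Nil [simp]: "prime_parking []"
  by (simp add: prime_parking_iff is_word_def)

lemma prime_parking_imp_parking: "prime_parking u \<Longrightarrow> parking u"
  by (simp add: prime_parking_def)

lemma parking_imp_is_word: "parking u \<Longrightarrow> is_word u"
  by (simp add: parking_def)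

lemma parking_letter_le_length:
  assumes "parking u" "x \<in> set u"
  shows "x \<le> length u"
proof (rule ccontr)
  assume "\<not> x \<le> length u"
  then have "letters_le u (length u) < length u"
    unfolding letters_le_def using assms(2) by (intro length_filter_less)
  moreover have "length u \<in> {1..length u}" using assms(2) by (cases u) auto
  ultimately show False using assms(1) unfolding parking_iff by (metis leD)
qed

lemma finite_parking: "finite {u. parking u \<and> length u = n}"
  by (rule finite_subset[of _ "{u. set u \<subseteq> {..n} \<and> length u = n}"])
    (auto simp: finite_lists_length_eq dest: parking_letter_le_length)

lemma finite_prime_parking: "finite {u. prime_parking u \<and> length u = n}"
  by (rule finite_subset[OF _ finite_parking[of n]]) (auto simp: prime_parking_def)

lemma bij_betw_prime_parking:
  "bij_betw (\<lambda>v. map (\<lambda>j. Suc (v j)) [0..<n]) (vector_park_funs (max 1) {..<n})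
    {u. prime_parking u \<and> length u = n}"
proof (rule bij_betw_byWitness[where f' = "\<lambda>u. \<lambda>j\<in>{..<n}. u ! j - 1"])
  let ?word = "\<lambda>v :: nat \<Rightarrow> nat. map (\<lambda>j. Suc (v j)) [0..<n]"
  have letters: "letters_le (?word v) i = card {p \<in> {..<n}. v p < i}" for v i
    by (subst letters_le_map) (auto simp: Suc_le_eq intro!: arg_cong[where f = card])
  show "?word ` vector_park_funs (max 1) {..<n} \<subseteq> {u. prime_parking u \<and> length u = n}"
    by (auto simp: vector_park_funs_def prime_parking_iff is_word_def letters)
  have word_pred: "?word (\<lambda>j\<in>{..<n}. u ! j - 1) = u" if "is_word u" "length u = n" for u
    using that by (intro nth_equalityI) (auto simp: is_word_def Suc_le_eq)
  then show "\<forall>u\<in>{u. prime_parking u \<and> length u = n}. ?word (\<lambda>j\<in>{..<n}. u ! j - 1) = u"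
    by (auto simp: prime_parking_iff)
  show "(\<lambda>u. \<lambda>j\<in>{..<n}. u ! j - 1) ` {u. prime_parking u \<and> length u = n}
      \<subseteq> vector_park_funs (max 1) {..<n}"
  proof clarify
    fix u assume u: "prime_parking u" "n = length u"
    then have "letters_le u i = card {p \<in> {..<n}. (\<lambda>j\<in>{..<n}. u ! j - 1) p < i}" for i
      using letters[of "\<lambda>j\<in>{..<n}. u ! j - 1" i] word_pred[of u] by (simp add: prime_parking_iff)
    then show "(\<lambda>j\<in>{..<length u}. u ! j - 1) \<in> vector_park_funs (max 1) {..<length u}"
      using u by (simp add: vector_park_funs_def prime_parking_iff)
  qed
qed (auto simp: vector_park_funs_def fun_eq_iff PiE_def extensional_def)

lemma card_prime_parking:
  assumes "n \<ge> 1"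
  shows "card {u. prime_parking u \<and> length u = n} = (n - 1) ^ (n - 1)"
  using bij_betw_same_card[OF bij_betw_prime_parking[of n]]
    card_vector_park_funs_max[of "{..<n}"] assms
  by (auto simp: lessThan_empty_iff)

section \<open>Counting rooted forests\<close>

definition parent_relations :: "'a set \<Rightarrow> 'b set \<Rightarrow> ('a \<times> 'b) set set" where
  "parent_relations A S = {D. D \<subseteq> A \<times> S \<and> (\<forall>s\<in>S. \<exists>!a. (a, s) \<in> D)}"

lemma Range_parent_relations: "D \<in> parent_relations A S \<Longrightarrow> Range D = S"
  by (auto simp: parent_relations_def)

lemma bij_betw_parent_relations: "bij_betw (\<lambda>g. (\<lambda>s. (g s, s)) ` S) (S \<rightarrow>\<^sub>E A) (parent_relations A S)"
  unfolding bij_betw_def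
proof
  show "inj_on (\<lambda>g. (\<lambda>s. (g s, s)) ` S) (S \<rightarrow>\<^sub>E A)"
  proof (rule inj_onI)
    fix g h assume g: "g \<in> S \<rightarrow>\<^sub>E A" and h: "h \<in> S \<rightarrow>\<^sub>E A"
      and graphs_eq: "(\<lambda>s. (g s, s)) ` S = (\<lambda>s. (h s, s)) ` S"
    have "g s = h s" if "s \<in> S" for s
    proof -
      have "(g s, s) \<in> (\<lambda>s. (h s, s)) ` S" using that unfolding graphs_eq[symmetric] by blast
      then show ?thesis by blast
    qed
    then show "g = h" using PiE_ext[OF g h] by blast
  qed
  show "(\<lambda>g. (\<lambda>s. (g s, s)) ` S) ` (S \<rightarrow>\<^sub>E A) = parent_relations A S"
  proof
    show "parent_relations A S \<subseteq> (\<lambda>g. (\<lambda>s. (g s, s)) ` S) ` (S \<rightarrow>\<^sub>E A)"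
    proof
      fix D assume D: "D \<in> parent_relations A S"
      then have "\<forall>s\<in>S. \<exists>a. (a, s) \<in> D" unfolding parent_relations_def by blast
      then obtain g where g: "\<And>s. s \<in> S \<Longrightarrow> (g s, s) \<in> D" by metis
      have "D = (\<lambda>s. (restrict g S s, s)) ` S"
      proof
        show "D \<subseteq> (\<lambda>s. (restrict g S s, s)) ` S"
        proof clarify
          fix a s assume as: "(a, s) \<in> D"
          then have s: "s \<in> S" using D by (auto simp: parent_relations_def)
          then have "a = g s" using as g D by (auto simp: parent_relations_def)
          then show "(a, s) \<in> (\<lambda>s. (restrict g S s, s)) ` S" using s by simp
        qed
      qed (use g in auto)
      moreover have "restrict g S \<in> S \<rightarrow>\<^sub>E A" using g D by (auto simp: parent_relations_def)
      ultimately show "D \<in> (\<lambda>g. (\<lambda>s. (g s, s)) ` S) ` (S \<rightarrow>\<^sub>E A)" by blast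
    qed
  qed (auto simp: parent_relations_def)
qed

lemma card_parent_relations: "finite S \<Longrightarrow> card (parent_relations A S) = card A ^ card S"
  using bij_betw_same_card[OF bij_betw_parent_relations[of S A]] by (simp add: card_PiE)

definition rooted_forests :: "'a set \<Rightarrow> 'a set \<Rightarrow> ('a \<times> 'a) set set" where
  "rooted_forests R V = {E. E \<subseteq> V \<times> V \<and> single_valued (E\<inverse>) \<and> V - Range E = R \<and>
     (\<forall>v\<in>V. \<exists>r\<in>R. (r, v) \<in> E\<^sup>*)}"

lemma finite_rooted_forests: "finite V \<Longrightarrow> finite (rooted_forests R V)"
  by (rule finite_subset[of _ "Pow (V \<times> V)"]) (auto simp: rooted_forests_def)

lemma rooted_forests_parent_unique:
  "E \<in> rooted_forests R V \<Longrightarrow> (u, v) \<in> E \<Longrightarrow> (u', v) \<in> E \<Longrightarrow> u = u'"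
  by (auto simp: rooted_forests_def single_valued_def)

lemma Range_rooted_forests: "E \<in> rooted_forests R V \<Longrightarrow> Range E = V - R"
  by (auto simp: rooted_forests_def)

lemma rooted_forests_graft:
  assumes T: "T \<in> rooted_forests Q R" and E: "E \<in> rooted_forests R V"
  shows "E \<union> T \<in> rooted_forests Q V"
proof -
  have sub: "T \<subseteq> R \<times> R" "E \<subseteq> V \<times> V" "R \<subseteq> V" using T E by (auto simp: rooted_forests_def)
  note ranges = Range_rooted_forests[OF T] Range_rooted_forests[OF E]
  have "u = u'" if "(u, v) \<in> E \<union> T" "(u', v) \<in> E \<union> T" for u u' v
    using that ranges rooted_forests_parent_unique[OF T] rooted_forests_parent_unique[OF E] by blast
  moreover have "\<exists>q\<in>Q. (q, v) \<in> (E \<union> T)\<^sup>*" if v: "v \<in> V" for v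
  proof -
    obtain r where r: "r \<in> R" "(r, v) \<in> E\<^sup>*" using E v unfolding rooted_forests_def by blast
    obtain q where q: "q \<in> Q" "(q, r) \<in> T\<^sup>*" using T r(1) unfolding rooted_forests_def by blast
    have "(q, r) \<in> (E \<union> T)\<^sup>*" "(r, v) \<in> (E \<union> T)\<^sup>*"
      using q(2) r(2) by (meson Un_upper1 Un_upper2 in_mono rtrancl_mono)+
    then show ?thesis using q(1) rtrancl_trans by metis
  qed
  moreover have "V - Range (E \<union> T) = Q"
  proof -
    have "V - Range (E \<union> T) = R - Range T" using sub ranges by blast
    then show ?thesis using T by (simp add: rooted_forests_def)
  qed
  ultimately show ?thesis
    using sub by (auto simp: rooted_forests_def single_valued_def)
qed

lemma parent_relations_subset_rooted_forests:
  assumes "R \<inter> S = {}"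
  shows "parent_relations R S \<subseteq> rooted_forests R (R \<union> S)"
proof
  fix D assume D: "D \<in> parent_relations R S"
  have "\<exists>r\<in>R. (r, v) \<in> D\<^sup>*" if "v \<in> R \<union> S" for v
  proof (cases "v \<in> R")
    case False
    then show ?thesis using that D unfolding parent_relations_def by blast
  qed blast
  moreover have "single_valued (D\<inverse>)" using D by (auto simp: parent_relations_def single_valued_def)
  moreover have "D \<subseteq> (R \<union> S) \<times> (R \<union> S)" using D by (auto simp: parent_relations_def)
  ultimately show "D \<in> rooted_forests R (R \<union> S)"
    using assms Range_parent_relations[OF D] by (auto simp: rooted_forests_def)
qed

lemma rooted_forests_add_isolated_roots:
  assumes "E \<in> rooted_forests S W" "R \<inter> W = {}"
  shows "E \<in> rooted_forests (R \<union> S) (R \<union> W)"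
proof -
  have "E \<subseteq> W \<times> W" "W - Range E = S" using assms(1) by (simp_all add: rooted_forests_def)
  then have "E \<subseteq> (R \<union> W) \<times> (R \<union> W)" "R \<union> W - Range E = R \<union> S" using assms(2) by blast+
  then show ?thesis using assms(1) by (auto simp: rooted_forests_def)
qed

lemma rooted_forests_attach_roots:
  assumes "R \<subseteq> V" "S \<subseteq> V - R"
    and D: "D \<in> parent_relations R S" and E: "E \<in> rooted_forests S (V - R)"
  shows "D \<union> E \<in> rooted_forests R V" "(D \<union> E) `` R = S"
proof -
  have "E \<in> rooted_forests (R \<union> S) (R \<union> (V - R))"
    using E by (rule rooted_forests_add_isolated_roots) blast
  then have "E \<in> rooted_forests (R \<union> S) V" using assms(1) by (simp add: Un_absorb1)
  moreover have "D \<in> rooted_forests R (R \<union> S)"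
    using D assms(2) parent_relations_subset_rooted_forests[of R S] by blast
  ultimately show "D \<union> E \<in> rooted_forests R V" by (metis rooted_forests_graft Un_commute)
  have "D \<subseteq> R \<times> S" using D by (simp add: parent_relations_def)
  moreover have "E \<subseteq> (V - R) \<times> (V - R)" using E by (simp add: rooted_forests_def)
  ultimately show "(D \<union> E) `` R = S" using Range_parent_relations[OF D] by blast
qed

lemma rooted_forests_subset:
  assumes E: "E \<in> rooted_forests R V" and "E' \<subseteq> E"
  shows "E' \<in> rooted_forests (V - Range E') V"
proof -
  have "\<exists>s\<in>V - Range E'. (s, v) \<in> E'\<^sup>*" if v: "v \<in> V" for v
  proof -
    obtain r where r: "r \<in> R" "(r, v) \<in> E\<^sup>*" using E v unfolding rooted_forests_def by blast
    from r(2) show ?thesis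
    proof (induction rule: rtrancl_induct)
      case base
      have "r \<in> V - Range E'" using r(1) E assms(2) by (auto simp: rooted_forests_def)
      then show ?case by blast
    next
      case (step y z)
      show ?case
      proof (cases "(y, z) \<in> E'")
        case True
        then show ?thesis using step.IH by (meson rtrancl.rtrancl_into_rtrancl)
      next
        case False
        then have "z \<notin> Range E'"
          using step.hyps(2) assms(2) rooted_forests_parent_unique[OF E] by blast
        moreover have "z \<in> V" using step.hyps(2) E by (auto simp: rooted_forests_def)
        ultimately show ?thesis by blast
      qed
    qed
  qed
  moreover have "single_valued (E'\<inverse>)"
    using rooted_forests_parent_unique[OF E] assms(2) by (blast intro: single_valuedI)
  ultimately show ?thesis using assms by (auto simp: rooted_forests_def)
qed

lemma rooted_forests_remove_roots:
  assumes F: "F \<in> rooted_forests R V"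
  shows "F \<inter> R \<times> V \<in> parent_relations R (F `` R)" "F - R \<times> V \<in> rooted_forests (F `` R) (V - R)"
proof -
  let ?E = "F - R \<times> V"
  note parent = rooted_forests_parent_unique[OF F]
  have sub: "F \<subseteq> V \<times> V" using F by (simp add: rooted_forests_def)
  note range = Range_rooted_forests[OF F]
  show "F \<inter> R \<times> V \<in> parent_relations R (F `` R)"
    using sub parent unfolding parent_relations_def by blast
  have "\<exists>s\<in>F `` R. (s, v) \<in> ?E\<^sup>*" if v: "v \<in> V - R" for v
  proof -
    obtain a where a: "a \<in> R" "(a, v) \<in> F\<^sup>*" using F v unfolding rooted_forests_def by blast
    from a(2) have "v \<in> R \<or> (\<exists>s\<in>F `` R. (s, v) \<in> ?E\<^sup>*)"
    proof (induction rule: rtrancl_induct)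
      case (step y z)
      show ?case
      proof (cases "y \<in> R")
        case False
        then have "(y, z) \<in> ?E" using step.hyps by blast
        then show ?thesis using step.IH False by (meson rtrancl.rtrancl_into_rtrancl)
      qed (use step.hyps in blast)
    qed (use a in simp)
    then show ?thesis using v by blast
  qed
  moreover have "?E \<subseteq> (V - R) \<times> (V - R)" using sub range by blast
  moreover have "V - R - Range ?E = F `` R" using sub range parent by blast
  moreover have "single_valued (?E\<inverse>)" using parent by (auto simp: single_valued_def)
  ultimately show "?E \<in> rooted_forests (F `` R) (V - R)" by (simp add: rooted_forests_def)
qed

lemma card_rooted_forests_Image_eq:
  assumes "finite V" "R \<subseteq> V" "S \<subseteq> V - R"
  shows "card {F \<in> rooted_forests R V. F `` R = S}
    = card R ^ card S * card (rooted_forests S (V - R))"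
proof -
  have "bij_betw (\<lambda>(D, E). D \<union> E) (parent_relations R S \<times> rooted_forests S (V - R))
      {F \<in> rooted_forests R V. F `` R = S}"
  proof (rule bij_betw_byWitness[where f' = "\<lambda>F. (F \<inter> R \<times> V, F - R \<times> V)"])
    have "(D \<union> E) \<inter> R \<times> V = D" "(D \<union> E) - R \<times> V = E"
      if "D \<in> parent_relations R S" "E \<in> rooted_forests S (V - R)" for D E
      using that assms(3) by (auto simp: parent_relations_def rooted_forests_def)
    then show "\<forall>x\<in>parent_relations R S \<times> rooted_forests S (V - R).
        (\<lambda>F. (F \<inter> R \<times> V, F - R \<times> V)) ((\<lambda>(D, E). D \<union> E) x) = x"
      by simp
    show "(\<lambda>(D, E). D \<union> E) ` (parent_relations R S \<times> rooted_forests S (V - R))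
        \<subseteq> {F \<in> rooted_forests R V. F `` R = S}"
      using rooted_forests_attach_roots[OF assms(2,3)] by clarsimp
    show "(\<lambda>F. (F \<inter> R \<times> V, F - R \<times> V)) ` {F \<in> rooted_forests R V. F `` R = S}
        \<subseteq> parent_relations R S \<times> rooted_forests S (V - R)"
      using rooted_forests_remove_roots by blast
  qed auto
  then have "card {F \<in> rooted_forests R V. F `` R = S}
      = card (parent_relations R S \<times> rooted_forests S (V - R))"
    by (simp add: bij_betw_same_card)
  also have "\<dots> = card R ^ card S * card (rooted_forests S (V - R))"
    using finite_subset[OF assms(3)] assms(1)
    by (simp add: card_cartesian_product card_parent_relations)
  finally show ?thesis .
qed

lemma card_rooted_forests:
  assumes "finite V" "R \<subseteq> V"
  shows "card (rooted_forests R V) = abel_count (card R) (card (V - R))"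
  using assms
proof (induction V arbitrary: R rule: finite_psubset_induct)
  case (psubset V)
  consider "R = V" | "R = {}" "V \<noteq> {}" | "R \<noteq> {}" "R \<subset> V" using psubset.prems by blast
  then show ?case
  proof cases
    case 1
    then have "rooted_forests R V = {{}}" by (auto simp: rooted_forests_def single_valued_def)
    then show ?thesis using 1 by simp
  next
    case 2
    then have "rooted_forests R V = {}" by (auto simp: rooted_forests_def)
    then show ?thesis using 2 psubset.hyps by (simp add: abel_count_0_left card_gt_0_iff)
  next
    case 3
    have "card (rooted_forests R V) = (\<Sum>S\<in>Pow (V - R). card {F \<in> rooted_forests R V. F `` R = S})"
    proof (rule card_eq_sum_card_fibres)
      show "(\<lambda>F. F `` R) ` rooted_forests R V \<subseteq> Pow (V - R)" using Range_rooted_forests by blast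
    qed (use psubset.hyps in \<open>simp_all add: finite_rooted_forests\<close>)
    also have "\<dots> = (\<Sum>S\<in>Pow (V - R). card R ^ card S * abel_count (card S) (card (V - R - S)))"
    proof (rule sum.cong)
      fix S assume "S \<in> Pow (V - R)"
      then have S: "S \<subseteq> V - R" by simp
      have "V - R \<subset> V" using 3 by blast
      then show "card {F \<in> rooted_forests R V. F `` R = S}
          = card R ^ card S * abel_count (card S) (card (V - R - S))"
        using card_rooted_forests_Image_eq[OF psubset.hyps psubset.prems S] psubset.IH[OF _ S]
        by simp
    qed simp
    also have "\<dots> = abel_count (card R) (card (V - R))"
      using psubset.hyps by (simp add: sum_Pow_abel_count)
    finally show ?thesis .
  qed
qed

lemma rooted_tree_iff: "rooted_tree V r E \<longleftrightarrow> E \<in> rooted_forests {r} V"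
proof
  assume tree: "rooted_tree V r E"
  then have "u = u'" if "(u, v) \<in> E" "(u', v) \<in> E" for u u' v
    using that unfolding rooted_tree_def by blast
  then have "single_valued (E\<inverse>)" by (auto simp: single_valued_def)
  moreover have "V - Range E = {r}" using tree unfolding rooted_tree_def by blast
  ultimately show "E \<in> rooted_forests {r} V"
    using tree by (simp add: rooted_tree_def rooted_forests_def)
next
  assume E: "E \<in> rooted_forests {r} V"
  have "\<exists>!u. (u, v) \<in> E" if "v \<in> V - {r}" for v
    using that Range_rooted_forests[OF E] rooted_forests_parent_unique[OF E] by blast
  moreover have "r \<in> V" "\<forall>u. (u, r) \<notin> E" using E by (auto simp: rooted_forests_def)
  ultimately show "rooted_tree V r E"
    using E by (simp add: rooted_tree_def rooted_forests_def)
qed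

definition min_rooted_trees :: "'a::linorder set \<Rightarrow> ('a \<times> 'a) set set" where
  "min_rooted_trees V = {E. \<exists>r. E \<in> rooted_forests {r} V \<and> (\<forall>v. (r, v) \<in> E \<longrightarrow> r < v)}"

lemma finite_min_rooted_trees: "finite V \<Longrightarrow> finite (min_rooted_trees V)"
  by (rule finite_subset[of _ "Pow (V \<times> V)"]) (auto simp: min_rooted_trees_def rooted_forests_def)

text \<open>Here \<open>S\<close> consists of the root and its children.\<close>

lemma min_rooted_trees_eq_UN:
  assumes V: "finite V"
  shows "min_rooted_trees V
    = (\<Union>S\<in>Pow V - {{}}. {E \<in> rooted_forests {Min S} V. E `` {Min S} = S - {Min S}})"
    (is "_ = (\<Union>S\<in>_. ?trees S)")
proof
  show "min_rooted_trees V \<subseteq> (\<Union>S\<in>Pow V - {{}}. ?trees S)"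
  proof
    fix E assume "E \<in> min_rooted_trees V"
    then obtain r where E: "E \<in> rooted_forests {r} V" and root_less: "\<And>v. (r, v) \<in> E \<Longrightarrow> r < v"
      by (auto simp: min_rooted_trees_def)
    let ?S = "insert r (E `` {r})"
    have S_subset: "?S \<subseteq> V" using E by (auto simp: rooted_forests_def)
    have "Min ?S = r"
      using finite_subset[OF S_subset V] root_less by (intro Min_eqI) (auto intro: less_imp_le)
    moreover have "E `` {r} = ?S - {r}" using root_less by blast
    ultimately show "E \<in> (\<Union>S\<in>Pow V - {{}}. ?trees S)"
      using E S_subset by (intro UN_I[of ?S]) auto
  qed
  show "(\<Union>S\<in>Pow V - {{}}. ?trees S) \<subseteq> min_rooted_trees V"
  proof
    fix E assume "E \<in> (\<Union>S\<in>Pow V - {{}}. ?trees S)"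
    then obtain S where S: "S \<subseteq> V" and E: "E \<in> ?trees S" by blast
    have "Min S < v" if "(Min S, v) \<in> E" for v
    proof -
      have "v \<in> S" "v \<noteq> Min S" using that E by blast+
      then show ?thesis
        using finite_subset[OF S V] by (metis Min_le order.not_eq_order_implies_strict)
    qed
    then show "E \<in> min_rooted_trees V" using E by (auto simp: min_rooted_trees_def)
  qed
qed

lemma card_min_rooted_trees:
  assumes V: "finite V" "V \<noteq> {}"
  shows "card (min_rooted_trees V) = (card V - 1) ^ (card V - 1)"
proof -
  let ?T = "\<lambda>S. {E \<in> rooted_forests {Min S} V. E `` {Min S} = S - {Min S}}"
  have Min_in: "finite S" "Min S \<in> S" if "S \<in> Pow V - {{}}" for S
    using that finite_subset[OF _ V(1), of S] by auto
  have "S = S'" if "S \<in> Pow V - {{}}" "S' \<in> Pow V - {{}}" "E \<in> ?T S" "E \<in> ?T S'" for S S' E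
  proof -
    have "{Min S} = {Min S'}" using that(3,4) by (auto simp: rooted_forests_def)
    then show ?thesis using that(3,4) Min_in[OF that(1)] Min_in[OF that(2)] by auto
  qed
  then have disjoint: "\<forall>S\<in>Pow V - {{}}. \<forall>S'\<in>Pow V - {{}}. S \<noteq> S' \<longrightarrow> ?T S \<inter> ?T S' = {}"
    by (meson IntE equals0I)
  have "card (?T S) = abel_count (card S - 1) (card (V - S))" if S: "S \<in> Pow V - {{}}" for S
  proof -
    have "V - {Min S} - (S - {Min S}) = V - S" using Min_in[OF S] by blast
    moreover have sub: "{Min S} \<subseteq> V" "S - {Min S} \<subseteq> V - {Min S}" using Min_in[OF S] S by blast+
    moreover have "card (S - {Min S}) = card S - 1" using Min_in[OF S] by simp
    ultimately show ?thesis
      using V(1) card_rooted_forests_Image_eq[OF V(1) sub] card_rooted_forests[OF _ sub(2)] by simp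
  qed
  then have "card (min_rooted_trees V) = (\<Sum>S\<in>Pow V - {{}}. abel_count (card S - 1) (card (V - S)))"
    using V(1) disjoint unfolding min_rooted_trees_eq_UN[OF V(1)]
    by (subst card_UN_disjoint) (auto simp: finite_rooted_forests)
  also have "abel_count 0 (card V) = 0" using V by (simp add: abel_count_0_left card_gt_0_iff)
  then have "(\<Sum>S\<in>Pow V - {{}}. abel_count (card S - 1) (card (V - S)))
      = (\<Sum>S\<in>Pow V. abel_count (card S - 1) (card (V - S)))"
    using V(1) by (intro sum.mono_neutral_left) auto
  also have "\<dots> = (card V - 1) ^ (card V - 1)" by (rule sum_Pow_abel_count_pred[OF V])
  finally show ?thesis .
qed

section \<open>Forests as assemblies of trees\<close>

definition rooted_trees :: "'a set \<Rightarrow> ('a \<times> 'a) set set" where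
  "rooted_trees Q = {E. \<exists>r. E \<in> rooted_forests {r} Q}"

definition tree_at :: "('a \<times> 'a) set \<Rightarrow> 'a \<Rightarrow> 'a set \<times> ('a \<times> 'a) set" where
  "tree_at E r = (E\<^sup>* `` {r}, E \<inter> E\<^sup>* `` {r} \<times> E\<^sup>* `` {r})"

lemma rooted_forests_root_unique:
  assumes E: "E \<in> rooted_forests R V" and r: "r \<in> R" "r' \<in> R"
    and reach: "(r, v) \<in> E\<^sup>*" "(r', v) \<in> E\<^sup>*"
  shows "r = r'"
  using reach
proof (induction rule: rtrancl_induct)
  case base
  then show ?case using r Range_rooted_forests[OF E] by (metis DiffD2 RangeI rtranclE)
next
  case (step y z)
  have "r' \<noteq> z" using step.hyps(2) r Range_rooted_forests[OF E] by blast
  then obtain y' where "(r', y') \<in> E\<^sup>*" "(y', z) \<in> E" using step.prems by (metis rtranclE)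
  then show ?case using step rooted_forests_parent_unique[OF E] by metis
qed

lemma rooted_forests_reachable_subset:
  assumes "E \<in> rooted_forests R V" "r \<in> R"
  shows "E\<^sup>* `` {r} \<subseteq> V"
proof -
  have "E `` V \<subseteq> V" "r \<in> V" using assms by (auto simp: rooted_forests_def)
  then show ?thesis using Image_closed_trancl[of E V] by blast
qed

lemma snd_tree_at_rooted_forests:
  assumes E: "E \<in> rooted_forests R V" and r: "r \<in> R"
  shows "snd (tree_at E r) \<in> rooted_forests {r} (fst (tree_at E r))"
proof -
  let ?Q = "E\<^sup>* `` {r}"
  let ?T = "E \<inter> ?Q \<times> ?Q"
  have "single_valued (?T\<inverse>)" using E by (auto simp: rooted_forests_def single_valued_def)
  moreover have "?Q - Range ?T = {r}"
  proof -
    have "v \<in> Range ?T" if v: "v \<in> ?Q" "v \<noteq> r" for v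
    proof -
      have "(r, v) \<in> E\<^sup>*" using v(1) by blast
      from rtranclE[OF this] obtain u where "(r, u) \<in> E\<^sup>*" "(u, v) \<in> E" using v(2) by blast
      then show ?thesis using v(1) by blast
    qed
    then show ?thesis using r Range_rooted_forests[OF E] by blast
  qed
  moreover have "(r, v) \<in> ?T\<^sup>*" if "v \<in> ?Q" for v
  proof -
    have "(r, v) \<in> E\<^sup>*" using that by blast
    then show ?thesis
    proof (induction rule: rtrancl_induct)
      case (step y z)
      then have "(y, z) \<in> ?T" by (auto intro: rtrancl_into_rtrancl)
      then show ?case using step.IH by (rule rtrancl_into_rtrancl[rotated])
    qed simp
  qed
  ultimately show ?thesis by (auto simp: rooted_forests_def tree_at_def)
qed

lemma inj_on_tree_at:
  assumes "E \<in> rooted_forests R V"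
  shows "inj_on (\<lambda>r. fst (tree_at E r)) R"
proof (rule inj_onI)
  fix r r' assume r: "r \<in> R" "r' \<in> R" "fst (tree_at E r) = fst (tree_at E r')"
  then have "(r', r) \<in> E\<^sup>*" by (auto simp: tree_at_def)
  then show "r = r'" using rooted_forests_root_unique[OF assms r(1,2)] by blast
qed

lemma tree_at_in_assemblies:
  assumes E: "E \<in> rooted_forests R V"
    and F: "\<And>r. r \<in> R \<Longrightarrow> snd (tree_at E r) \<in> F (fst (tree_at E r))"
  shows "tree_at E ` R \<in> assemblies F V"
proof -
  have "inj_on fst (tree_at E ` R)"
    using inj_on_tree_at[OF E] by (intro inj_on_imageI) (simp add: comp_def)
  moreover have "partition_on V (fst ` tree_at E ` R)"
    unfolding partition_on_def
  proof (intro conjI)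
    have "\<exists>r\<in>R. (r, v) \<in> E\<^sup>*" if "v \<in> V" for v using E that by (simp add: rooted_forests_def)
    then show "\<Union>(fst ` tree_at E ` R) = V"
      using rooted_forests_reachable_subset[OF E] by (fastforce simp: tree_at_def)
    show "disjoint (fst ` tree_at E ` R)"
      using rooted_forests_root_unique[OF E] by (fastforce simp: disjoint_def tree_at_def)
    show "{} \<notin> fst ` tree_at E ` R" by (auto simp: tree_at_def)
  qed
  ultimately show ?thesis using F by (auto simp: assemblies_def case_prod_beta)
qed

lemma Union_tree_at:
  assumes E: "E \<in> rooted_forests R V"
  shows "\<Union>(snd ` tree_at E ` R) = E"
proof
  show "E \<subseteq> \<Union>(snd ` tree_at E ` R)"
  proof clarify
    fix u v assume uv: "(u, v) \<in> E"
    then have "u \<in> V" using E by (auto simp: rooted_forests_def)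
    then obtain r where r: "r \<in> R" "(r, u) \<in> E\<^sup>*" using E by (auto simp: rooted_forests_def)
    then have "(u, v) \<in> snd (tree_at E r)"
      using uv by (auto simp: tree_at_def intro: rtrancl_into_rtrancl)
    then show "(u, v) \<in> \<Union>(snd ` tree_at E ` R)" using r(1) by blast
  qed
qed (auto simp: tree_at_def)

lemma assemblies_block_unique:
  assumes "C \<in> assemblies F V" "(Q, M) \<in> C" "(Q', M') \<in> C" "x \<in> Q" "x \<in> Q'"
  shows "(Q, M) = (Q', M')"
proof -
  have "Q \<in> fst ` C" "Q' \<in> fst ` C" using assms(2,3) by force+
  then have "Q = Q'"
    using assms disjointD[OF partition_onD2, of V "fst ` C" Q Q'] by (auto simp: assemblies_def)
  moreover have "inj_on fst C" using assms(1) by (simp add: assemblies_def)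
  ultimately show ?thesis using inj_onD[of fst C "(Q, M)" "(Q', M')"] assms(2,3) by simp
qed

context
  fixes C :: "('a set \<times> ('a \<times> 'a) set) set" and V
  assumes C: "C \<in> assemblies rooted_trees V"
begin

lemma assembly_tree:
  assumes "(Q, T) \<in> C"
  obtains r where "T \<in> rooted_forests {r} Q"
  using C assms by (auto simp: assemblies_def rooted_trees_def)

lemma assembly_tree_subset: "(Q, T) \<in> C \<Longrightarrow> T \<subseteq> Q \<times> Q"
  by (erule assembly_tree) (simp add: rooted_forests_def)

lemma assembly_block:
  assumes "v \<in> V"
  obtains Q T where "(Q, T) \<in> C" "v \<in> Q"
  using C assms by (force simp: assemblies_def partition_on_def)

lemma assembly_edge_in_tree:
  assumes "(Q, T) \<in> C" "(u, v) \<in> \<Union>(snd ` C)" "u \<in> Q \<or> v \<in> Q"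
  shows "(u, v) \<in> T"
proof -
  obtain Q' T' where T': "(Q', T') \<in> C" "(u, v) \<in> T'" using assms(2) by force
  then have "u \<in> Q'" "v \<in> Q'" using assembly_tree_subset by blast+
  then have "(Q, T) = (Q', T')" using assms(3) assemblies_block_unique[OF C assms(1) T'(1)] by blast
  then show ?thesis using T'(2) by simp
qed

lemma assembly_Range_iff:
  assumes Q: "(Q, T) \<in> C" and T: "T \<in> rooted_forests {r} Q" and v: "v \<in> Q"
  shows "v \<in> Range (\<Union>(snd ` C)) \<longleftrightarrow> v \<noteq> r"
proof -
  have "v \<in> Range (\<Union>(snd ` C)) \<longleftrightarrow> v \<in> Range T"
  proof
    show "v \<in> Range T" if "v \<in> Range (\<Union>(snd ` C))"
      using that assembly_edge_in_tree[OF Q] v by blast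
    show "v \<in> Range (\<Union>(snd ` C))" if "v \<in> Range T" using that Q by force
  qed
  then show ?thesis using Range_rooted_forests[OF T] v by blast
qed

lemma tree_at_assembly:
  assumes Q: "(Q, T) \<in> C" and T: "T \<in> rooted_forests {r} Q"
  shows "tree_at (\<Union>(snd ` C)) r = (Q, T)"
proof -
  let ?E = "\<Union>(snd ` C)"
  have T_subset: "T \<subseteq> ?E" using Q by force
  have "?E `` Q \<subseteq> Q" "r \<in> Q"
    using assembly_edge_in_tree[OF Q] assembly_tree_subset[OF Q] T
    by (blast, auto simp: rooted_forests_def)
  then have "?E\<^sup>* `` {r} \<subseteq> Q" using Image_closed_trancl[of ?E Q] by blast
  moreover have "Q \<subseteq> ?E\<^sup>* `` {r}"
    using T rtrancl_mono[OF T_subset] by (auto simp: rooted_forests_def)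
  moreover have "?E \<inter> Q \<times> Q = T"
    using assembly_edge_in_tree[OF Q] assembly_tree_subset[OF Q] T_subset by blast
  ultimately show ?thesis by (simp add: tree_at_def)
qed

lemma Union_assembly_rooted_forests:
  "\<Union>(snd ` C) \<in> rooted_forests (V - Range (\<Union>(snd ` C))) V"
proof -
  let ?E = "\<Union>(snd ` C)"
  have block_subset: "Q \<subseteq> V" if "(Q, T) \<in> C" for Q T
    using C that by (force simp: assemblies_def partition_on_def)
  have "?E \<subseteq> V \<times> V" using assembly_tree_subset block_subset by fastforce
  moreover have "u = u'" if uv: "(u, v) \<in> ?E" "(u', v) \<in> ?E" for u u' v
  proof -
    obtain Q T where Q: "(Q, T) \<in> C" "(u, v) \<in> T" using uv(1) by force
    then have "(u', v) \<in> T" using assembly_edge_in_tree[OF Q(1) uv(2)] assembly_tree_subset by blast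
    then show ?thesis using Q assembly_tree[OF Q(1)] rooted_forests_parent_unique by metis
  qed
  moreover have "\<exists>r\<in>V - Range ?E. (r, v) \<in> ?E\<^sup>*" if v: "v \<in> V" for v
  proof -
    obtain Q T where Q: "(Q, T) \<in> C" "v \<in> Q" using assembly_block[OF v] .
    obtain r where T: "T \<in> rooted_forests {r} Q" using assembly_tree[OF Q(1)] .
    have "r \<in> Q" using T by (auto simp: rooted_forests_def)
    then have "r \<in> V - Range ?E" using assembly_Range_iff[OF Q(1) T] block_subset[OF Q(1)] by blast
    moreover have "(r, v) \<in> ?E\<^sup>*"
      using tree_at_assembly[OF Q(1) T] Q(2) by (auto simp: tree_at_def)
    ultimately show ?thesis by blast
  qed
  ultimately show ?thesis by (auto simp: rooted_forests_def single_valued_def)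
qed

lemma tree_at_roots_assembly:
  "tree_at (\<Union>(snd ` C)) ` (V - Range (\<Union>(snd ` C))) = C"
proof (intro set_eqI iffI)
  fix c assume "c \<in> tree_at (\<Union>(snd ` C)) ` (V - Range (\<Union>(snd ` C)))"
  then obtain r where r: "r \<in> V" "r \<notin> Range (\<Union>(snd ` C))" and c: "c = tree_at (\<Union>(snd ` C)) r"
    by blast
  obtain Q T where Q: "(Q, T) \<in> C" "r \<in> Q" using assembly_block[OF r(1)] .
  obtain r' where T: "T \<in> rooted_forests {r'} Q" using assembly_tree[OF Q(1)] .
  have "r = r'" using assembly_Range_iff[OF Q(1) T Q(2)] r(2) by blast
  then show "c \<in> C" using tree_at_assembly[OF Q(1) T] Q(1) c by simp
next
  fix c assume "c \<in> C"
  then obtain Q T where c: "c = (Q, T)" and Q: "(Q, T) \<in> C" by (cases c) blast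
  obtain r where T: "T \<in> rooted_forests {r} Q" using assembly_tree[OF Q] .
  have "r \<in> Q" using T by (auto simp: rooted_forests_def)
  moreover have "Q \<subseteq> V" using C Q by (force simp: assemblies_def partition_on_def)
  ultimately have "r \<in> V - Range (\<Union>(snd ` C))" using assembly_Range_iff[OF Q T] by blast
  then show "c \<in> tree_at (\<Union>(snd ` C)) ` (V - Range (\<Union>(snd ` C)))"
    using tree_at_assembly[OF Q T] c by (metis imageI)
qed

end

lemma bij_betw_Union_assemblies:
  assumes F: "\<And>Q. F Q \<subseteq> rooted_trees Q"
  shows "bij_betw (\<lambda>C. \<Union>(snd ` C)) (assemblies F V)
    {E \<in> rooted_forests (V - Range E) V.
      \<forall>r\<in>V - Range E. snd (tree_at E r) \<in> F (fst (tree_at E r))}"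
    (is "bij_betw _ _ ?forests")
proof (rule bij_betw_byWitness[where f' = "\<lambda>E. tree_at E ` (V - Range E)"])
  have trees: "C \<in> assemblies rooted_trees V" if "C \<in> assemblies F V" for C
    using that F by (fastforce simp: assemblies_def)
  then show "\<forall>C\<in>assemblies F V. tree_at (\<Union>(snd ` C)) ` (V - Range (\<Union>(snd ` C))) = C"
    using tree_at_roots_assembly by blast
  show "\<forall>E\<in>?forests. \<Union>(snd ` tree_at E ` (V - Range E)) = E"
    using Union_tree_at by blast
  have "snd (tree_at (\<Union>(snd ` C)) r) \<in> F (fst (tree_at (\<Union>(snd ` C)) r))"
    if C: "C \<in> assemblies F V" and r: "r \<in> V - Range (\<Union>(snd ` C))" for C r
  proof -
    have "tree_at (\<Union>(snd ` C)) r \<in> C" using tree_at_roots_assembly[OF trees[OF C]] r by blast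
    then show ?thesis using C by (auto simp: assemblies_def)
  qed
  then show "(\<lambda>C. \<Union>(snd ` C)) ` assemblies F V \<subseteq> ?forests"
    using Union_assembly_rooted_forests[OF trees] by (intro image_subsetI CollectI conjI ballI)
  show "(\<lambda>E. tree_at E ` (V - Range E)) ` ?forests \<subseteq> assemblies F V"
    using tree_at_in_assemblies by blast
qed

definition min_rooted_forests :: "'a::linorder set \<Rightarrow> ('a \<times> 'a) set set" where
  "min_rooted_forests V = {E \<in> rooted_forests (V - Range E) V. \<forall>(u, v)\<in>E. u \<notin> Range E \<longrightarrow> u < v}"

lemma snd_tree_at_min_rooted_trees_iff:
  assumes E: "E \<in> rooted_forests R V" and r: "r \<in> R"
  shows "snd (tree_at E r) \<in> min_rooted_trees (fst (tree_at E r)) \<longleftrightarrow> (\<forall>v. (r, v) \<in> E \<longrightarrow> r < v)"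
proof -
  note tree = snd_tree_at_rooted_forests[OF E r]
  have "r' = r" if "snd (tree_at E r) \<in> rooted_forests {r'} (fst (tree_at E r))" for r'
    using that tree by (auto simp: rooted_forests_def)
  then have "snd (tree_at E r) \<in> min_rooted_trees (fst (tree_at E r))
      \<longleftrightarrow> (\<forall>v. (r, v) \<in> snd (tree_at E r) \<longrightarrow> r < v)"
    using tree by (auto simp: min_rooted_trees_def)
  then show ?thesis by (auto simp: tree_at_def)
qed

lemma card_min_rooted_forests:
  "card (min_rooted_forests V) = card (assemblies min_rooted_trees V)"
proof -
  have "(\<forall>r\<in>V - Range E. snd (tree_at E r) \<in> min_rooted_trees (fst (tree_at E r)))
      \<longleftrightarrow> (\<forall>(u, v)\<in>E. u \<notin> Range E \<longrightarrow> u < v)" if E: "E \<in> rooted_forests (V - Range E) V" for E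
  proof -
    have "E \<subseteq> V \<times> V" using E by (simp add: rooted_forests_def)
    then show ?thesis using snd_tree_at_min_rooted_trees_iff[OF E] by blast
  qed
  then have "{E \<in> rooted_forests (V - Range E) V. \<forall>r\<in>V - Range E.
      snd (tree_at E r) \<in> min_rooted_trees (fst (tree_at E r))} = min_rooted_forests V"
    by (auto simp: min_rooted_forests_def)
  moreover have "min_rooted_trees Q \<subseteq> rooted_trees Q" for Q :: "'a set"
    by (auto simp: min_rooted_trees_def rooted_trees_def)
  ultimately show ?thesis
    using bij_betw_same_card[OF bij_betw_Union_assemblies[of min_rooted_trees V]] by simp
qed

section \<open>Trees with a decreasing chain\<close>

definition decreasing_part :: "('a::linorder \<times> 'a) set \<Rightarrow> 'a \<Rightarrow> 'a set" where
  "decreasing_part E r = (E \<inter> {(u, v). v < u})\<^sup>* `` {r}"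

lemma root_in_decreasing_part: "r \<in> decreasing_part E r"
  by (simp add: decreasing_part_def)

lemma decreasing_part_step:
  "(u, v) \<in> E \<Longrightarrow> u \<in> decreasing_part E r \<Longrightarrow> v < u \<Longrightarrow> v \<in> decreasing_part E r"
  by (auto simp: decreasing_part_def intro: rtrancl_into_rtrancl)

lemma decreasing_part_parent:
  assumes E: "E \<in> rooted_forests {r} V" and uv: "(u, v) \<in> E" and v: "v \<in> decreasing_part E r"
  shows "u \<in> decreasing_part E r" "v < u"
proof -
  have "(r, v) \<in> (E \<inter> {(u, v). v < u})\<^sup>*" using v by (simp add: decreasing_part_def)
  moreover have "v \<noteq> r" using uv Range_rooted_forests[OF E] by blast
  ultimately obtain u' where "(r, u') \<in> (E \<inter> {(u, v). v < u})\<^sup>*" "(u', v) \<in> E" "v < u'"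
    by (auto elim: rtranclE)
  moreover then have "u' = u" using uv rooted_forests_parent_unique[OF E] by blast
  ultimately show "u \<in> decreasing_part E r" "v < u" by (simp_all add: decreasing_part_def)
qed

lemma decreasing_part_subset:
  assumes "E \<in> rooted_forests {r} V"
  shows "decreasing_part E r \<subseteq> V"
proof -
  have "decreasing_part E r \<subseteq> E\<^sup>* `` {r}"
    unfolding decreasing_part_def by (intro Image_mono rtrancl_mono) auto
  then show ?thesis using rooted_forests_reachable_subset[OF assms] by blast
qed

lemma decreasing_subtree_subset_decreasing_part:
  assumes S: "decreasing_subtree r E S"
  shows "S \<subseteq> decreasing_part E r"
proof
  fix v assume "v \<in> S"
  then have "(r, v) \<in> (E \<inter> S \<times> S)\<^sup>*" using S by (simp add: decreasing_subtree_def rooted_tree_def)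
  moreover have "E \<inter> S \<times> S \<subseteq> E \<inter> {(u, v). v < u}"
    using S unfolding decreasing_subtree_def by blast
  then have "(E \<inter> S \<times> S)\<^sup>* \<subseteq> (E \<inter> {(u, v). v < u})\<^sup>*" by (rule rtrancl_mono)
  ultimately show "v \<in> decreasing_part E r" by (auto simp: decreasing_part_def)
qed

lemma decreasing_subtree_decreasing_part:
  assumes T: "rooted_tree V r E"
  shows "decreasing_subtree r E (decreasing_part E r)"
proof -
  let ?E = "E \<inter> {(u, v). v < u}"
  let ?D = "decreasing_part E r"
  have E: "E \<in> rooted_forests {r} V" using T by (simp add: rooted_tree_iff)
  have "?E \<in> rooted_forests (V - Range ?E) V" using rooted_forests_subset[OF E] by blast
  moreover have "r \<in> V - Range ?E" using E by (auto simp: rooted_forests_def)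
  ultimately have "?E \<inter> ?D \<times> ?D \<in> rooted_forests {r} ?D"
    unfolding decreasing_part_def using snd_tree_at_rooted_forests[of ?E]
    by (auto simp: tree_at_def)
  moreover have "?E \<inter> ?D \<times> ?D = E \<inter> ?D \<times> ?D" using decreasing_part_parent[OF E] by blast
  ultimately show ?thesis
    using decreasing_part_parent[OF E] by (auto simp: decreasing_subtree_def rooted_tree_iff)
qed

lemma max_decreasing_subtree_iff:
  assumes "rooted_tree V r E"
  shows "max_decreasing_subtree V r E S \<longleftrightarrow> S = decreasing_part E r"
proof -
  have "decreasing_part E r \<subseteq> V"
    using assms decreasing_part_subset by (simp add: rooted_tree_iff)
  then show ?thesis
    using decreasing_subtree_decreasing_part[OF assms]
      decreasing_subtree_subset_decreasing_part[of r E]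
    unfolding max_decreasing_subtree_def by blast
qed

definition path_edges :: "'a list \<Rightarrow> ('a \<times> 'a) set" where
  "path_edges xs = set (zip xs (tl xs))"

lemma path_edges_conv_nth: "path_edges xs = {(xs ! i, xs ! Suc i) | i. Suc i < length xs}"
  by (auto simp: path_edges_def set_zip nth_tl)

lemma path_edges_rooted_forests:
  "xs \<noteq> [] \<Longrightarrow> distinct xs \<Longrightarrow> path_edges xs \<in> rooted_forests {hd xs} (set xs)"
proof (induction xs)
  case (Cons x ys)
  show ?case
  proof (cases "ys = []")
    case True
    then show ?thesis by (auto simp: path_edges_def rooted_forests_def single_valued_def)
  next
    case False
    have "{(x, hd ys)} \<union> path_edges ys \<in> rooted_forests {x} (set (x # ys))"
    proof (rule rooted_forests_attach_roots)
      show "path_edges ys \<in> rooted_forests {hd ys} (set (x # ys) - {x})"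
        using Cons False by simp
      show "{(x, hd ys)} \<in> parent_relations {x} {hd ys}" by (auto simp: parent_relations_def)
    qed (use Cons.prems False in auto)
    moreover have "path_edges (x # ys) = {(x, hd ys)} \<union> path_edges ys"
      using False by (cases ys) (simp_all add: path_edges_def)
    ultimately show ?thesis by simp
  qed
qed simp

lemma path_edges_decreasing:
  assumes "sorted_wrt (>) (xs :: 'a::linorder list)" "(u, v) \<in> path_edges xs"
  shows "v < u"
  using assms sorted_wrt_nth_less[OF assms(1)] by (auto simp: path_edges_conv_nth)

definition decreasing_path :: "'a::linorder set \<Rightarrow> ('a \<times> 'a) set" where
  "decreasing_path S = path_edges (rev (sorted_list_of_set S))"

lemma decreasing_path_less: "(u, v) \<in> decreasing_path S \<Longrightarrow> v < u"
  unfolding decreasing_path_def by (rule path_edges_decreasing) (simp_all add: sorted_wrt_rev)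

lemma hd_sorted_wrt_greater:
  assumes "sorted_wrt (>) (xs :: 'a::linorder list)" "xs \<noteq> []"
  shows "hd xs = Max (set xs)"
  using assms by (cases xs) (auto intro!: Max_eqI[symmetric] simp: less_imp_le)

lemma hd_rev_sorted_list_of_set:
  "finite S \<Longrightarrow> S \<noteq> {} \<Longrightarrow> hd (rev (sorted_list_of_set S)) = Max S"
  using hd_sorted_wrt_greater[of "rev (sorted_list_of_set S)"] by (simp add: sorted_wrt_rev)

lemma decreasing_path_rooted_forests:
  assumes "finite S" "S \<noteq> {}"
  shows "decreasing_path S \<in> rooted_forests {Max S} S"
  using path_edges_rooted_forests[of "rev (sorted_list_of_set S)"] assms
  by (simp add: decreasing_path_def hd_rev_sorted_list_of_set)

lemma chain_from_decreasing_iff: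
  assumes decreasing: "\<And>u v. (u, v) \<in> E \<inter> S \<times> S \<Longrightarrow> v < u"
  shows "chain_from r E S \<longleftrightarrow> finite S \<and> S \<noteq> {} \<and> r = Max S \<and> E \<inter> S \<times> S = decreasing_path S"
proof
  assume "chain_from r E S"
  then obtain xs where xs: "xs \<noteq> []" "hd xs = r" "set xs = S" "E \<inter> S \<times> S = path_edges xs"
    by (auto simp: chain_from_def path_edges_conv_nth)
  have "sorted_wrt (>) xs"
  proof (subst sorted_wrt_iff_nth_Suc_transp)
    show "transp ((>) :: nat \<Rightarrow> nat \<Rightarrow> bool)" by (auto simp: transp_def)
    show "\<forall>i. Suc i < length xs \<longrightarrow> xs ! Suc i < xs ! i"
      using decreasing unfolding xs(4) path_edges_conv_nth by blast
  qed
  then have "sorted_list_of_set S = rev xs"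
    using xs(3) strict_sorted_equal[of "sorted_list_of_set S" "rev xs"]
    by (auto simp: sorted_wrt_rev)
  then have rev_sorted: "rev (sorted_list_of_set S) = xs" by simp
  have "finite S" "S \<noteq> {}" using xs(1,3) by auto
  then show "finite S \<and> S \<noteq> {} \<and> r = Max S \<and> E \<inter> S \<times> S = decreasing_path S"
    using hd_rev_sorted_list_of_set[of S] xs(2,4) by (simp add: rev_sorted decreasing_path_def)
next
  assume S: "finite S \<and> S \<noteq> {} \<and> r = Max S \<and> E \<inter> S \<times> S = decreasing_path S"
  then have "rev (sorted_list_of_set S) \<noteq> []" "hd (rev (sorted_list_of_set S)) = r"
    using hd_rev_sorted_list_of_set[of S] by auto
  then show "chain_from r E S"
    unfolding chain_from_def using S
    by (intro exI[of _ "rev (sorted_list_of_set S)"])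
      (simp add: decreasing_path_def path_edges_conv_nth)
qed

lemma chain_trees_iff:
  "(r, E) \<in> chain_trees n \<longleftrightarrow> E \<in> rooted_forests {r} {1..n} \<and> r = Max (decreasing_part E r) \<and>
     E \<inter> decreasing_part E r \<times> decreasing_part E r = decreasing_path (decreasing_part E r)"
proof (cases "rooted_tree {1..n} r E")
  case True
  then have E: "E \<in> rooted_forests {r} {1..n}" by (simp add: rooted_tree_iff)
  have "finite (decreasing_part E r)"
    using decreasing_part_subset[OF E] by (rule finite_subset) simp
  moreover have "decreasing_part E r \<noteq> {}" using root_in_decreasing_part by blast
  moreover have "v < u" if "(u, v) \<in> E \<inter> decreasing_part E r \<times> decreasing_part E r" for u v
    using that decreasing_part_parent[OF E] by blast
  ultimately have "chain_from r E (decreasing_part E r) \<longleftrightarrow> r = Max (decreasing_part E r) \<and>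
      E \<inter> decreasing_part E r \<times> decreasing_part E r = decreasing_path (decreasing_part E r)"
    using chain_from_decreasing_iff[of E "decreasing_part E r" r] by blast
  moreover have "(r, E) \<in> chain_trees n \<longleftrightarrow> chain_from r E (decreasing_part E r)"
    using True max_decreasing_subtree_iff[OF True] by (simp add: chain_trees_def)
  ultimately show ?thesis using E by blast
qed (simp add: chain_trees_def rooted_tree_iff)

lemma graft_decreasing_path:
  assumes E: "E \<in> min_rooted_forests V" and V: "finite V" "V \<noteq> {}" and R: "R = V - Range E"
  shows "E \<union> decreasing_path R \<in> rooted_forests {Max R} V"
    "decreasing_part (E \<union> decreasing_path R) (Max R) = R"
    "(E \<union> decreasing_path R) \<inter> R \<times> R = decreasing_path R"
    "(E \<union> decreasing_path R) - R \<times> R = E"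
proof -
  let ?T = "E \<union> decreasing_path R"
  have forest: "E \<in> rooted_forests R V" and root_less: "\<And>u v. (u, v) \<in> E \<Longrightarrow> u \<in> R \<Longrightarrow> u < v"
    using E R by (auto simp: min_rooted_forests_def)
  have "finite R" "R \<noteq> {}" using V R forest by (auto simp: rooted_forests_def)
  then have path: "decreasing_path R \<in> rooted_forests {Max R} R"
    by (rule decreasing_path_rooted_forests)
  show "?T \<in> rooted_forests {Max R} V" by (rule rooted_forests_graft[OF path forest])
  have path_subset: "decreasing_path R \<subseteq> R \<times> R" using path by (simp add: rooted_forests_def)
  then show "?T \<inter> R \<times> R = decreasing_path R" "?T - R \<times> R = E" using R by blast+
  show "decreasing_part ?T (Max R) = R"
  proof
    have "(?T \<inter> {(u, v). v < u}) `` R \<subseteq> R" using root_less path_subset by (auto dest: order.asym)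
    moreover have "Max R \<in> R" using \<open>finite R\<close> \<open>R \<noteq> {}\<close> by (rule Max_in)
    ultimately show "decreasing_part ?T (Max R) \<subseteq> R"
      using Image_closed_trancl[of "?T \<inter> {(u, v). v < u}" R] by (auto simp: decreasing_part_def)
    have "decreasing_path R \<subseteq> ?T \<inter> {(u, v). v < u}" using decreasing_path_less by auto
    then have "(decreasing_path R)\<^sup>* \<subseteq> (?T \<inter> {(u, v). v < u})\<^sup>*" by (rule rtrancl_mono)
    then show "R \<subseteq> decreasing_part ?T (Max R)"
      using path by (auto simp: rooted_forests_def decreasing_part_def)
  qed
qed

lemma cut_decreasing_part:
  assumes T: "T \<in> rooted_forests {r} V" and D: "D = decreasing_part T r"
  shows "V - Range (T - D \<times> D) = D" "T - D \<times> D \<in> min_rooted_forests V"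
proof -
  have root_in_D: "r \<in> D" using root_in_decreasing_part by (simp add: D)
  show roots: "V - Range (T - D \<times> D) = D"
  proof
    show "D \<subseteq> V - Range (T - D \<times> D)"
      using decreasing_part_subset[OF T] decreasing_part_parent[OF T] unfolding D by blast
    show "V - Range (T - D \<times> D) \<subseteq> D" using Range_rooted_forests[OF T] root_in_D by blast
  qed
  have "u < v" if "(u, v) \<in> T - D \<times> D" "u \<notin> Range (T - D \<times> D)" for u v
  proof -
    have "u \<in> V" using that(1) T by (auto simp: rooted_forests_def)
    then have "u \<in> D" using that(2) roots by blast
    then have "v \<notin> D" using that(1) by blast
    then show ?thesis
      using \<open>u \<in> D\<close> that(1) decreasing_part_step[of u v T r] unfolding D
      by (metis Diff_iff linorder_neqE)
  qed
  then show "T - D \<times> D \<in> min_rooted_forests V"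
    using rooted_forests_subset[OF T] by (auto simp: min_rooted_forests_def)
qed

lemma bij_betw_chain_trees:
  assumes "n \<ge> 1"
  shows "bij_betw (\<lambda>E. let R = {1..n} - Range E in (Max R, E \<union> decreasing_path R))
    (min_rooted_forests {1..n}) (chain_trees n)"
    (is "bij_betw ?link _ _")
proof (rule bij_betw_byWitness[where
      f' = "\<lambda>(r, T). T - decreasing_part T r \<times> decreasing_part T r"])
  let ?cut = "\<lambda>(r, T). T - decreasing_part T r \<times> decreasing_part T r"
  have "{1..n} \<noteq> {}" using assms by simp
  note graft = graft_decreasing_path[OF _ finite_atLeastAtMost this refl]
  show "\<forall>E\<in>min_rooted_forests {1..n}. ?cut (?link E) = E"
    using graft(2,4) by (auto simp: Let_def)
  show "?link ` min_rooted_forests {1..n} \<subseteq> chain_trees n"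
    using graft(1-3) by (auto simp only: Let_def chain_trees_iff)
  show "\<forall>x\<in>chain_trees n. ?link (?cut x) = x"
  proof clarify
    fix r T assume T: "(r, T) \<in> chain_trees n"
    let ?D = "decreasing_part T r"
    have "{1..n} - Range (T - ?D \<times> ?D) = ?D"
      using T unfolding chain_trees_iff by (intro cut_decreasing_part(1)[OF _ refl]) blast
    moreover have "T - ?D \<times> ?D \<union> decreasing_path ?D = T" "r = Max ?D"
      using T unfolding chain_trees_iff by blast+
    ultimately show "?link (T - ?D \<times> ?D) = (r, T)" by (simp add: Let_def del: Diff_iff)
  qed
  show "?cut ` chain_trees n \<subseteq> min_rooted_forests {1..n}"
    using cut_decreasing_part(2)[OF _ refl] by (auto simp: chain_trees_iff)
qed

lemma card_chain_trees:
  assumes "n \<ge> 1"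
  shows "card (chain_trees n) = (\<Sum>k=1..n. A_inf n k)"
proof -
  have "card (chain_trees n) = card (min_rooted_forests {1..n})"
    by (rule bij_betw_same_card[OF bij_betw_chain_trees[OF assms], symmetric])
  also have "\<dots> = card (assemblies min_rooted_trees {1..n})" by (rule card_min_rooted_forests)
  also have "\<dots> = (\<Sum>k=1..n. A_inf n k)"
    using assms finite_min_rooted_trees card_min_rooted_trees by (rule card_assemblies_eq_sum_A_inf)
  finally show ?thesis .
qed

section \<open>Words and biwords\<close>

definition rank :: "nat set \<Rightarrow> nat \<Rightarrow> nat" where
  "rank L p = card {x \<in> L. x < p}"

lemma rank_nth_sorted_list_of_set:
  assumes "finite L" "t < card L"
  shows "rank L (sorted_list_of_set L ! t) = t"
proof -
  let ?xs = "sorted_list_of_set L"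
  have t: "t < length ?xs" using assms by simp
  have "sorted_wrt (<) (take t ?xs @ ?xs ! t # drop (Suc t) ?xs)"
    using id_take_nth_drop[OF t] by (metis strict_sorted_list_of_set)
  then have "{x \<in> set (take t ?xs @ ?xs ! t # drop (Suc t) ?xs). x < ?xs ! t} = set (take t ?xs)"
    by (auto simp: sorted_wrt_append)
  then have "{x \<in> L. x < ?xs ! t} = set (take t ?xs)"
    using id_take_nth_drop[OF t] assms(1) by (metis set_sorted_list_of_set)
  then show ?thesis using t by (simp add: rank_def distinct_card)
qed

lemma
  assumes "finite L" "p \<in> L"
  shows rank_less_card: "rank L p < card L"
    and nth_rank: "sorted_list_of_set L ! rank L p = p"
proof -
  have "p \<in> set (sorted_list_of_set L)" using assms by simp
  then obtain t where t: "t < card L" "sorted_list_of_set L ! t = p"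
    by (metis in_set_conv_nth length_sorted_list_of_set)
  then have "rank L p = t" using rank_nth_sorted_list_of_set[OF assms(1) t(1)] by simp
  then show "rank L p < card L" "sorted_list_of_set L ! rank L p = p" using t by auto
qed

lemma map_nth_rank:
  assumes "finite L" "length M = card L"
  shows "map (\<lambda>p. M ! rank L p) (sorted_list_of_set L) = M"
  using assms by (intro nth_equalityI) (simp_all add: rank_nth_sorted_list_of_set)

lemma ex_between_strict_mono:
  fixes f :: "nat \<Rightarrow> nat"
  assumes "strict_mono f" "f 0 < x"
  shows "\<exists>j. f j < x \<and> x \<le> f (Suc j)"
proof -
  define j where "j = (LEAST j. x \<le> f j)"
  have "x \<le> f j" unfolding j_def using strict_mono_imp_increasing[OF assms(1)] by (rule LeastI)
  moreover then obtain i where j: "j = Suc i" using assms(2) by (cases j) auto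
  moreover have "\<not> x \<le> f i" using not_less_Least[of i "\<lambda>j. x \<le> f j"] j unfolding j_def by simp
  ultimately show ?thesis by (auto simp: not_le)
qed

lemma between_mono_unique:
  fixes f :: "nat \<Rightarrow> 'a::linorder"
  assumes "mono f" "f i < x" "x \<le> f (Suc i)" "f j < x" "x \<le> f (Suc j)"
  shows "i = j"
proof -
  have "\<not> i < j" if "f j < x" "x \<le> f (Suc i)" for i j
    using that monoD[OF assms(1), of "Suc i" j] by auto
  then show ?thesis using assms(2-5) by (meson linorder_neqE_nat)
qed

definition positions_between :: "nat list \<Rightarrow> nat \<Rightarrow> nat \<Rightarrow> nat set" where
  "positions_between w a b = {p \<in> {1..length w}. a < w ! (p - 1) \<and> w ! (p - 1) \<le> b}"

lemma finite_positions_between [simp]: "finite (positions_between w a b)"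
  by (simp add: positions_between_def)

lemma letters_le_eq_card_positions: "letters_le w b = card {p \<in> {1..length w}. w ! (p - 1) \<le> b}"
proof -
  have "letters_le w b = letters_le (map (\<lambda>p. w ! (p - 1)) [1..<Suc (length w)]) b"
    by (rule arg_cong[where f = "\<lambda>u. letters_le u b"], rule nth_equalityI) (simp_all del: upt_Suc)
  also have "\<dots> = card {p \<in> {1..length w}. w ! (p - 1) \<le> b}"
    unfolding letters_le_map[OF distinct_upt] set_upt
    by (simp add: atLeastLessThanSuc_atLeastAtMost)
  finally show ?thesis .
qed

lemma letters_le_add_card_positions_between:
  assumes "a \<le> b"
  shows "letters_le w a + card (positions_between w a b) = letters_le w b"
proof -
  have "{p \<in> {1..length w}. w ! (p - 1) \<le> b}
      = {p \<in> {1..length w}. w ! (p - 1) \<le> a} \<union> positions_between w a b"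
    using assms by (auto simp: positions_between_def)
  moreover have "{p \<in> {1..length w}. w ! (p - 1) \<le> a} \<inter> positions_between w a b = {}"
    by (auto simp: positions_between_def)
  ultimately show ?thesis
    unfolding letters_le_eq_card_positions by (simp add: card_Un_disjoint)
qed

lemma letters_le_0: "is_word w \<Longrightarrow> letters_le w 0 = 0"
  by (auto simp: letters_le_def is_word_def filter_empty_conv)

lemma col_size_pos: "finite L \<Longrightarrow> 0 < col_size L"
  by (auto simp: col_size_def card_gt_0_iff)

lemma card_le_col_size: "card L \<le> col_size L"
  by (auto simp: col_size_def)

definition col_off :: "biword \<Rightarrow> nat \<Rightarrow> nat" where
  "col_off m j = (\<Sum>q<j. col_size (fst (m q)))"

lemma col_off_0 [simp]: "col_off m 0 = 0"
  by (simp add: col_off_def)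

lemma col_off_Suc: "col_off m (Suc j) = col_off m j + col_size (fst (m j))"
  by (simp add: col_off_def)

definition biword_length :: "biword \<Rightarrow> nat" where
  "biword_length m = card (\<Union>i. fst (m i))"

lemma length_Phi: "length (Phi m) = biword_length m"
  by (simp add: Phi_def biword_length_def del: upt_Suc)

context
  fixes m assumes m: "m \<in> BW"
begin

lemma BW_Union: "(\<Union>i. fst (m i)) = {1..biword_length m}"
proof -
  obtain n where "(\<Union>i. fst (m i)) = {1..n}" using m by (auto simp: BW_def)
  then show ?thesis by (simp add: biword_length_def)
qed

lemma BW_column_subset: "fst (m j) \<subseteq> {1..biword_length m}"
  using BW_Union by blast

lemma finite_BW_column: "finite (fst (m j))"
  by (rule finite_subset[OF BW_column_subset]) simp

lemma prime_parking_BW: "prime_parking (snd (m j))"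
  and length_snd_BW: "length (snd (m j)) = card (fst (m j))"
  using m by (auto simp: BW_def)

lemma BW_column_unique: "p \<in> fst (m i) \<Longrightarrow> p \<in> fst (m j) \<Longrightarrow> i = j"
  using m by (auto simp: BW_def)

lemma BW_empty_column: "fst (m j) = {} \<Longrightarrow> m j = ({}, [])"
  using length_snd_BW[of j] by (simp add: prod_eq_iff)

lemma strict_mono_col_off: "strict_mono (col_off m)"
  by (simp add: strict_mono_Suc_iff col_off_Suc col_size_pos finite_BW_column)

lemma Phi_nth:
  assumes "p \<in> fst (m j)"
  shows "Phi m ! (p - 1) = snd (m j) ! rank (fst (m j)) p + col_off m j"
proof -
  have "p \<in> {1..biword_length m}" using assms BW_column_subset by blast
  moreover have "(THE j. p \<in> fst (m j)) = j"
    using assms BW_column_unique by (intro the_equality) auto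
  ultimately show ?thesis
    by (auto simp: Phi_def Let_def biword_length_def[symmetric] rank_def col_off_def
        simp del: upt_Suc)
qed

lemma Phi_nth_bounds:
  assumes "p \<in> fst (m j)"
  shows "col_off m j < Phi m ! (p - 1)" "Phi m ! (p - 1) \<le> col_off m (Suc j)"
proof -
  let ?x = "snd (m j) ! rank (fst (m j)) p"
  have x: "?x \<in> set (snd (m j))"
    using rank_less_card[OF finite_BW_column assms] by (simp add: length_snd_BW)
  have parking: "parking (snd (m j))"
    using prime_parking_BW by (rule prime_parking_imp_parking)
  have "1 \<le> ?x" using parking_imp_is_word[OF parking] x by (simp add: is_word_def)
  moreover have "?x \<le> col_size (fst (m j))"
    using parking_letter_le_length[OF parking x] card_le_col_size[of "fst (m j)"]
    by (simp add: length_snd_BW)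
  ultimately show "col_off m j < Phi m ! (p - 1)" "Phi m ! (p - 1) \<le> col_off m (Suc j)"
    unfolding Phi_nth[OF assms] col_off_Suc by simp_all
qed

lemma positions_between_Phi:
  "positions_between (Phi m) (col_off m j) (col_off m (Suc j)) = fst (m j)"
proof (intro set_eqI iffI)
  fix p assume "p \<in> fst (m j)"
  then show "p \<in> positions_between (Phi m) (col_off m j) (col_off m (Suc j))"
    using Phi_nth_bounds BW_column_subset unfolding positions_between_def length_Phi by blast
next
  fix p assume p: "p \<in> positions_between (Phi m) (col_off m j) (col_off m (Suc j))"
  then have "p \<in> (\<Union>i. fst (m i))"
    unfolding BW_Union by (simp add: positions_between_def length_Phi)
  then obtain i where i: "p \<in> fst (m i)" by blast
  then have "i = j"
    using between_mono_unique[OF strict_mono_mono[OF strict_mono_col_off]] Phi_nth_bounds[OF i] p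
    unfolding positions_between_def by blast
  then show "p \<in> fst (m j)" using i by simp
qed

lemma card_positions_between_Phi:
  assumes i: "i \<le> col_size (fst (m j))"
  shows "card (positions_between (Phi m) (col_off m j) (col_off m j + i))
    = letters_le (snd (m j)) i"
proof -
  let ?L = "fst (m j)"
  have "positions_between (Phi m) (col_off m j) (col_off m j + i)
      = {p \<in> positions_between (Phi m) (col_off m j) (col_off m (Suc j)).
          Phi m ! (p - 1) \<le> col_off m j + i}"
    using i by (auto simp: positions_between_def col_off_Suc)
  also have "\<dots> = {p \<in> ?L. snd (m j) ! rank ?L p \<le> i}"
    unfolding positions_between_Phi using Phi_nth by auto
  also have "card \<dots> = letters_le (map (\<lambda>p. snd (m j) ! rank ?L p) (sorted_list_of_set ?L)) i"
    using finite_BW_column by (simp add: letters_le_map)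
  finally show ?thesis
    by (simp add: map_nth_rank finite_BW_column length_snd_BW)
qed

lemma is_word_Phi: "is_word (Phi m)"
  unfolding is_word_def
proof
  fix x assume "x \<in> set (Phi m)"
  then obtain k where k: "k < biword_length m" "x = Phi m ! k"
    by (auto simp: in_set_conv_nth length_Phi)
  then have "Suc k \<in> (\<Union>i. fst (m i))" using BW_Union by simp
  then obtain j where "Suc k \<in> fst (m j)" by blast
  then show "1 \<le> x" using Phi_nth_bounds(1)[of "Suc k" j] k by simp
qed

lemma letters_le_Phi_col_off: "letters_le (Phi m) (col_off m j) = (\<Sum>q<j. card (fst (m q)))"
proof (induction j)
  case (Suc j)
  have "col_off m j \<le> col_off m (Suc j)" by (simp add: col_off_Suc)
  then show ?case
    using letters_le_add_card_positions_between[of "col_off m j" "col_off m (Suc j)" "Phi m"] Suc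
    by (simp add: positions_between_Phi)
qed (simp add: letters_le_0 is_word_Phi)

end

text \<open>By primality, the column of a word after the offset \<open>a\<close> ends at the first value \<open>i\<close> for which
  at most \<open>i - a\<close> letters lie in \<open>(a, i]\<close>.\<close>

definition next_off :: "nat list \<Rightarrow> nat \<Rightarrow> nat" where
  "next_off w a = (LEAST i. a < i \<and> card (positions_between w a i) \<le> i - a)"

primrec word_off :: "nat list \<Rightarrow> nat \<Rightarrow> nat" where
  "word_off w 0 = 0"
| "word_off w (Suc j) = next_off w (word_off w j)"

definition word_column :: "nat list \<Rightarrow> nat \<Rightarrow> nat set" where
  "word_column w j = positions_between w (word_off w j) (word_off w (Suc j))"

definition biword_of :: "nat list \<Rightarrow> biword" where
  "biword_of w j =
     (word_column w j, map (\<lambda>p. w ! (p - 1) - word_off w j) (sorted_list_of_set (word_column w j)))"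

lemma fst_biword_of [simp]: "fst (biword_of w j) = word_column w j"
  by (simp add: biword_of_def)

lemma length_snd_biword_of: "length (snd (biword_of w j)) = card (word_column w j)"
  by (simp add: biword_of_def word_column_def)

lemma next_off_Phi:
  assumes m: "m \<in> BW"
  shows "next_off (Phi m) (col_off m j) = col_off m (Suc j)"
  unfolding next_off_def
proof (rule Least_equality)
  let ?a = "col_off m j"
  let ?c = "col_size (fst (m j))"
  have "card (positions_between (Phi m) ?a (?a + ?c)) \<le> ?c"
    using card_positions_between_Phi[OF m, of ?c j] letters_le_le_length[of "snd (m j)" ?c]
      card_le_col_size[of "fst (m j)"] by (simp add: length_snd_BW[OF m])
  then show "?a < col_off m (Suc j) \<and>
      card (positions_between (Phi m) ?a (col_off m (Suc j))) \<le> col_off m (Suc j) - ?a"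
    using col_size_pos[OF finite_BW_column[OF m]] by (simp add: col_off_Suc)
  fix i assume i: "?a < i \<and> card (positions_between (Phi m) ?a i) \<le> i - ?a"
  show "col_off m (Suc j) \<le> i"
  proof (rule ccontr)
    assume "\<not> col_off m (Suc j) \<le> i"
    moreover define t where "t = i - ?a"
    ultimately have t: "i = ?a + t" "1 \<le> t" "t < ?c" using i by (auto simp: col_off_Suc)
    then have "t < length (snd (m j))"
      by (auto simp: length_snd_BW[OF m] col_size_def split: if_splits)
    then have "t < letters_le (snd (m j)) t"
      using prime_parking_BW[OF m, of j] t(2) by (auto simp: prime_parking_iff max_def)
    then show False
      using i t card_positions_between_Phi[OF m, of t j] by simp
  qed
qed

lemma word_off_Phi: "m \<in> BW \<Longrightarrow> word_off (Phi m) j = col_off m j"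
  by (induction j) (simp_all add: next_off_Phi)

lemma biword_of_Phi:
  assumes m: "m \<in> BW"
  shows "biword_of (Phi m) = m"
proof
  fix j
  have column: "word_column (Phi m) j = fst (m j)"
    unfolding word_column_def word_off_Phi[OF m] by (rule positions_between_Phi[OF m])
  have "snd (biword_of (Phi m) j)
      = map (\<lambda>p. Phi m ! (p - 1) - col_off m j) (sorted_list_of_set (fst (m j)))"
    by (simp add: biword_of_def column word_off_Phi[OF m])
  also have "\<dots> = map (\<lambda>p. snd (m j) ! rank (fst (m j)) p) (sorted_list_of_set (fst (m j)))"
    using Phi_nth[OF m] finite_BW_column[OF m] by (intro map_cong) simp_all
  also have "\<dots> = snd (m j)" by (rule map_nth_rank[OF finite_BW_column[OF m] length_snd_BW[OF m]])
  finally show "biword_of (Phi m) j = m j" by (simp add: prod_eq_iff column)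
qed

lemma inj_on_Phi: "inj_on Phi BW"
  using biword_of_Phi by (rule inj_on_inverseI)

lemma
  shows next_off_greater: "a < next_off w a"
    and card_positions_between_next_off:
      "card (positions_between w a (next_off w a)) \<le> next_off w a - a"
proof -
  let ?P = "\<lambda>i. a < i \<and> card (positions_between w a i) \<le> i - a"
  have "card (positions_between w a (a + length w + 1)) \<le> card {1..length w}"
    by (rule card_mono) (auto simp: positions_between_def)
  then have "?P (a + length w + 1)" by simp
  then have "?P (next_off w a)" unfolding next_off_def by (rule LeastI)
  then show "a < next_off w a" "card (positions_between w a (next_off w a)) \<le> next_off w a - a"
    by auto
qed

lemma next_off_minimal: "a < i \<Longrightarrow> i < next_off w a \<Longrightarrow> i - a < card (positions_between w a i)"
  using not_less_Least[of i "\<lambda>i. a < i \<and> card (positions_between w a i) \<le> i - a"]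
  unfolding next_off_def by simp

lemma strict_mono_word_off: "strict_mono (word_off w)"
  by (simp add: strict_mono_Suc_iff next_off_greater)

definition word_width :: "nat list \<Rightarrow> nat \<Rightarrow> nat" where
  "word_width w j = word_off w (Suc j) - word_off w j"

lemma word_off_Suc_eq: "word_off w (Suc j) = word_off w j + word_width w j"
  using next_off_greater[of "word_off w j" w] by (simp add: word_width_def)

lemma word_width_pos: "0 < word_width w j"
  using next_off_greater[of "word_off w j" w] by (simp add: word_width_def)

lemma letters_le_snd_biword_of:
  assumes "i \<le> word_width w j"
  shows "letters_le (snd (biword_of w j)) i
    = card (positions_between w (word_off w j) (word_off w j + i))"
proof -
  have "{p \<in> word_column w j. w ! (p - 1) - word_off w j \<le> i}
      = positions_between w (word_off w j) (word_off w j + i)"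
    using assms unfolding word_column_def word_off_Suc_eq by (auto simp: positions_between_def)
  then show ?thesis
    by (simp add: biword_of_def letters_le_map word_column_def del: word_off.simps)
qed

lemma less_letters_le_snd_biword_of:
  assumes "1 \<le> i" "i < word_width w j"
  shows "i < letters_le (snd (biword_of w j)) i"
proof -
  have "word_off w j + i < next_off w (word_off w j)"
    using assms(2) word_off_Suc_eq[of w j] by simp
  then show ?thesis
    using assms next_off_minimal[of "word_off w j" "word_off w j + i" w]
    by (simp add: letters_le_snd_biword_of)
qed

lemma letters_le_word_width:
  "letters_le (snd (biword_of w j)) (word_width w j) = card (word_column w j)"
  by (simp add: letters_le_snd_biword_of word_column_def word_off_Suc_eq del: word_off.simps)

lemma col_size_word_column: "col_size (word_column w j) = word_width w j"
proof -
  let ?M = "snd (biword_of w j)"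
  let ?c = "card (word_column w j)"
  have card_le: "?c \<le> word_width w j"
    using card_positions_between_next_off[of w "word_off w j"]
    by (simp add: word_column_def word_width_def)
  show ?thesis
  proof (cases "word_width w j = 1")
    case True
    then show ?thesis using card_le by (auto simp: col_size_def word_column_def le_Suc_eq)
  next
    case False
    then have "word_width w j - 1 < letters_le ?M (word_width w j - 1)"
      using word_width_pos[of w j] by (intro less_letters_le_snd_biword_of) auto
    also have "\<dots> \<le> ?c" using letters_le_le_length[of ?M] by (simp add: length_snd_biword_of)
    finally have "?c = word_width w j" using card_le by simp
    then show ?thesis using word_width_pos[of w j] by (auto simp: col_size_def)
  qed
qed

lemma prime_parking_snd_biword_of: "prime_parking (snd (biword_of w j))"
  unfolding prime_parking_iff
proof (intro conjI allI impI)
  let ?M = "snd (biword_of w j)"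
  show "is_word ?M"
    by (auto simp: is_word_def biword_of_def word_column_def positions_between_def)
  fix k assume k: "k < length ?M"
  then have "word_column w j \<noteq> {}" by (auto simp: length_snd_biword_of)
  then have width: "word_width w j = length ?M"
    using col_size_word_column[of w j] by (simp add: col_size_def length_snd_biword_of)
  show "k < letters_le ?M (max 1 k)"
  proof (cases "max 1 k < word_width w j")
    case True
    then show ?thesis using less_letters_le_snd_biword_of[of "max 1 k" w j] by simp
  next
    case False
    then have "max 1 k = word_width w j" using k width by auto
    then show ?thesis
      using k width letters_le_word_width[of w j] by (simp add: length_snd_biword_of)
  qed
qed

context
  fixes w assumes w: "is_word w"
begin

lemma UN_word_column: "(\<Union>j. word_column w j) = {1..length w}"
proof
  show "{1..length w} \<subseteq> (\<Union>j. word_column w j)"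
  proof
    fix p assume p: "p \<in> {1..length w}"
    then have "w ! (p - 1) \<in> set w" by (intro nth_mem) auto
    then have "word_off w 0 < w ! (p - 1)" using w by (simp add: is_word_def Suc_le_eq)
    from ex_between_strict_mono[OF strict_mono_word_off this]
    show "p \<in> (\<Union>j. word_column w j)"
      using p by (auto simp: word_column_def positions_between_def)
  qed
qed (auto simp: word_column_def positions_between_def)

lemma biword_of_in_BW: "biword_of w \<in> BW"
proof -
  have "i = j" if "p \<in> word_column w i" "p \<in> word_column w j" for i j p
    using that between_mono_unique[OF strict_mono_mono[OF strict_mono_word_off]]
    unfolding word_column_def positions_between_def by blast
  then show ?thesis
    using UN_word_column prime_parking_snd_biword_of length_snd_biword_of
    by (auto simp: BW_def)
qed

lemma biword_length_biword_of: "biword_length (biword_of w) = length w"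
  by (simp add: biword_length_def UN_word_column)

lemma col_off_biword_of: "col_off (biword_of w) j = word_off w j"
  by (induction j)
    (simp_all add: col_off_Suc col_size_word_column word_off_Suc_eq del: word_off.simps(2))

lemma Phi_biword_of: "Phi (biword_of w) = w"
proof (rule nth_equalityI)
  show length: "length (Phi (biword_of w)) = length w"
    by (simp add: length_Phi biword_length_biword_of)
  fix k assume "k < length (Phi (biword_of w))"
  then have "Suc k \<in> (\<Union>j. word_column w j)" using length by (simp add: UN_word_column)
  then obtain j where j: "Suc k \<in> word_column w j" by blast
  have finite: "finite (word_column w j)" by (simp add: word_column_def)
  have "Phi (biword_of w) ! k = w ! k - word_off w j + word_off w j"
    using Phi_nth[OF biword_of_in_BW, of "Suc k" j] j
      rank_less_card[OF finite j] nth_rank[OF finite j]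
    by (simp add: col_off_biword_of) (simp add: biword_of_def)
  then show "Phi (biword_of w) ! k = w ! k"
    using j by (simp add: word_column_def positions_between_def)
qed

lemma the_inv_into_BW_Phi: "the_inv_into BW Phi w = biword_of w"
  using the_inv_into_f_f[OF inj_on_Phi biword_of_in_BW] by (simp add: Phi_biword_of)

end

section \<open>Parkization deletes the empty columns\<close>

definition columns :: "biword \<Rightarrow> (nat set \<times> nat list) set" where
  "columns m = m ` {j. fst (m j) \<noteq> {}}"

lemma reindex_BW:
  assumes m: "m \<in> BW" and f: "inj f" and range: "\<And>j. fst (m j) \<noteq> {} \<Longrightarrow> j \<in> range f"
  shows "m \<circ> f \<in> BW" "columns (m \<circ> f) = columns m" "biword_length (m \<circ> f) = biword_length m"
proof -
  have Union_eq: "(\<Union>i. fst ((m \<circ> f) i)) = (\<Union>i. fst (m i))"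
  proof
    show "(\<Union>i. fst (m i)) \<subseteq> (\<Union>i. fst ((m \<circ> f) i))"
    proof clarify
      fix p i assume "p \<in> fst (m i)"
      moreover then obtain j where "i = f j" using range[of i] by blast
      ultimately show "p \<in> (\<Union>i. fst ((m \<circ> f) i))" by auto
    qed
  qed auto
  then show "biword_length (m \<circ> f) = biword_length m" by (simp add: biword_length_def)
  have "fst (m (f i)) \<inter> fst (m (f j)) = {}" if "i \<noteq> j" for i j
    using BW_column_unique[OF m] injD[OF f] that by blast
  then show "m \<circ> f \<in> BW"
    using Union_eq BW_Union[OF m] prime_parking_BW[OF m] length_snd_BW[OF m] by (auto simp: BW_def)
  have "columns (m \<circ> f) = m ` {j \<in> range f. fst (m j) \<noteq> {}}" by (auto simp: columns_def)
  also have "{j \<in> range f. fst (m j) \<noteq> {}} = {j. fst (m j) \<noteq> {}}" using range by blast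
  finally show "columns (m \<circ> f) = columns m" by (simp add: columns_def)
qed

lemma finite_nonempty_columns:
  assumes "m \<in> BW"
  shows "finite {j. fst (m j) \<noteq> {}}"
proof (rule finite_subset)
  show "{j. fst (m j) \<noteq> {}} \<subseteq> (\<lambda>p. THE j. p \<in> fst (m j)) ` {1..biword_length m}"
  proof clarify
    fix j assume "fst (m j) \<noteq> {}"
    then obtain p where p: "p \<in> fst (m j)" by blast
    then have "(THE j. p \<in> fst (m j)) = j"
      using BW_column_unique[OF assms] by (intro the_equality) auto
    then show "j \<in> (\<lambda>p. THE j. p \<in> fst (m j)) ` {1..biword_length m}"
      using p BW_column_subset[OF assms, of j] by (intro image_eqI[of _ _ p]) auto
  qed
qed simp

definition skip :: "nat \<Rightarrow> nat \<Rightarrow> nat" where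
  "skip k j = (if j < k then j else Suc j)"

lemma inj_skip: "inj (skip k)"
  by (rule injI) (auto simp: skip_def split: if_splits)

lemma in_range_skip: "j \<noteq> k \<Longrightarrow> j \<in> range (skip k)"
  by (rule image_eqI[of _ _ "if j < k then j else j - 1"]) (auto simp: skip_def)

context
  fixes m k
  assumes m: "m \<in> BW" and empty: "fst (m k) = {}"
begin

lemma reindex_skip:
  shows "m \<circ> skip k \<in> BW" "columns (m \<circ> skip k) = columns m"
    "biword_length (m \<circ> skip k) = biword_length m"
proof -
  have "j \<in> range (skip k)" if "fst (m j) \<noteq> {}" for j
    using that empty by (metis in_range_skip)
  from reindex_BW[OF m inj_skip this] show "m \<circ> skip k \<in> BW" "columns (m \<circ> skip k) = columns m"
    "biword_length (m \<circ> skip k) = biword_length m" by blast+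
qed

lemma col_off_skip_before: "j \<le> k \<Longrightarrow> col_off (m \<circ> skip k) j = col_off m j"
  unfolding col_off_def by (rule sum.cong) (auto simp: skip_def)

lemma col_off_skip_after: "k \<le> j \<Longrightarrow> col_off (m \<circ> skip k) j + 1 = col_off m (Suc j)"
proof (induction rule: dec_induct)
  case base
  then show ?case
    using col_off_skip_before[of k] empty by (simp add: col_off_Suc col_size_def comp_def)
next
  case (step j)
  then show ?case by (simp add: col_off_Suc skip_def)
qed

lemma Phi_skip:
  "Phi (m \<circ> skip k) = map (\<lambda>x. if col_off m k + 1 < x then x - 1 else x) (Phi m)"
proof (rule nth_equalityI)
  show length: "length (Phi (m \<circ> skip k))
      = length (map (\<lambda>x. if col_off m k + 1 < x then x - 1 else x) (Phi m))"
    by (simp add: length_Phi reindex_skip(3))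
  fix i assume i: "i < length (Phi (m \<circ> skip k))"
  then have "Suc i \<in> (\<Union>j. fst ((m \<circ> skip k) j))"
    unfolding BW_Union[OF reindex_skip(1)] by (simp add: length_Phi)
  then obtain j where j: "Suc i \<in> fst (m (skip k j))" by auto
  note bounds = Phi_nth_bounds[OF m j]
  have Phi_nth_shift: "Phi (m \<circ> skip k) ! i + col_off m (skip k j)
      = Phi m ! i + col_off (m \<circ> skip k) j"
    using Phi_nth[OF reindex_skip(1), of "Suc i" j] Phi_nth[OF m j] j by simp
  have "Phi (m \<circ> skip k) ! i = (if col_off m k + 1 < Phi m ! i then Phi m ! i - 1 else Phi m ! i)"
  proof (cases "j < k")
    case True
    then have "col_off m (Suc j) \<le> col_off m k"
      by (intro strict_mono_leD[OF strict_mono_col_off[OF m]]) simp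
    then show ?thesis using True Phi_nth_shift bounds by (simp add: col_off_skip_before skip_def)
  next
    case False
    then have "col_off m (Suc k) \<le> col_off m (Suc j)"
      by (intro strict_mono_leD[OF strict_mono_col_off[OF m]]) simp
    then show ?thesis
      using False Phi_nth_shift bounds col_off_skip_after[of j] empty
      by (simp add: col_off_Suc[of m k] col_size_def skip_def)
  qed
  then show "Phi (m \<circ> skip k) ! i = map (\<lambda>x. if col_off m k + 1 < x then x - 1 else x) (Phi m) ! i"
    using i length by simp
qed

lemma park_d_Phi:
  assumes first: "\<And>j. j < k \<Longrightarrow> fst (m j) \<noteq> {}"
  shows "park_d (Phi m) = col_off m k + 1"
  unfolding park_d_def letters_le_conv_card[symmetric]
proof (rule Least_equality)
  have full: "letters_le (Phi m) (col_off m j) = col_off m j" if "j \<le> k" for j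
    unfolding letters_le_Phi_col_off[OF m] unfolding col_off_def
    by (rule sum.cong) (use that first in \<open>auto simp: col_size_def\<close>)
  have "letters_le (Phi m) (col_off m (Suc k)) = letters_le (Phi m) (col_off m k)"
    using empty by (simp add: letters_le_Phi_col_off[OF m])
  then show "1 \<le> col_off m k + 1 \<and> letters_le (Phi m) (col_off m k + 1) < col_off m k + 1"
    using full[of k] empty by (simp add: col_off_Suc col_size_def)
  fix i assume i: "1 \<le> i \<and> letters_le (Phi m) i < i"
  show "col_off m k + 1 \<le> i"
  proof (rule ccontr)
    assume "\<not> col_off m k + 1 \<le> i"
    obtain j where j: "col_off m j < i" "i \<le> col_off m (Suc j)"
      using ex_between_strict_mono[OF strict_mono_col_off[OF m], of i] i by auto
    then have "col_off m j < col_off m k" using \<open>\<not> col_off m k + 1 \<le> i\<close> by simp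
    then have "j < k" using strict_mono_less[OF strict_mono_col_off[OF m]] by blast
    define t where "t = i - col_off m j"
    have t: "i = col_off m j + t" "1 \<le> t" "t \<le> col_size (fst (m j))"
      using j by (auto simp: t_def col_off_Suc)
    have "col_size (fst (m j)) = length (snd (m j))"
      using first[OF \<open>j < k\<close>] by (simp add: col_size_def length_snd_BW[OF m])
    then have "t \<le> letters_le (snd (m j)) t"
      using prime_parking_imp_parking[OF prime_parking_BW[OF m, of j]] t by (simp add: parking_iff)
    also have "col_off m j + letters_le (snd (m j)) t = letters_le (Phi m) i"
      using letters_le_add_card_positions_between[of "col_off m j" i "Phi m"] full[of j] \<open>j < k\<close> t
        card_positions_between_Phi[OF m, of t j] by simp
    finally show False using i t by simp
  qed
qed

end

definition columns_of :: "nat list \<Rightarrow> (nat set \<times> nat list) set" where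
  "columns_of w = columns (biword_of w)"

lemma columns_of_Phi: "m \<in> BW \<Longrightarrow> columns_of (Phi m) = columns m"
  by (simp add: columns_of_def biword_of_Phi)

lemma columns_of_park_step:
  assumes w: "is_word w"
  defines "w' \<equiv> map (\<lambda>x. if park_d w < x then x - 1 else x) w"
  shows "is_word w'" "columns_of w' = columns_of w"
proof -
  define m where "m = biword_of w"
  have m: "m \<in> BW" and Phi_m: "Phi m = w"
    using biword_of_in_BW[OF w] Phi_biword_of[OF w] by (simp_all add: m_def)
  define k where "k = (LEAST j. fst (m j) = {})"
  have "\<exists>j. fst (m j) = {}"
    using ex_new_if_finite[OF infinite_UNIV_nat finite_nonempty_columns[OF m]] by simp
  then have k: "fst (m k) = {}" unfolding k_def by (rule LeastI_ex)
  have "fst (m j) \<noteq> {}" if "j < k" for j using not_less_Least that unfolding k_def by blast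
  then have w'_eq: "w' = Phi (m \<circ> skip k)"
    using Phi_skip[OF m k] park_d_Phi[OF m k] by (simp add: w'_def Phi_m)
  show "is_word w'" unfolding w'_eq by (rule is_word_Phi[OF reindex_skip(1)[OF m k]])
  have "columns_of w' = columns m"
    unfolding w'_eq using reindex_skip[OF m k] by (simp add: columns_of_Phi)
  then show "columns_of w' = columns_of w" by (simp add: columns_of_def[of w] m_def)
qed

lemma parking_if_park_d_eq_Suc_length:
  assumes "is_word w" "park_d w = length w + 1"
  shows "parking w"
proof -
  have "i \<le> letters_le w i" if "i \<in> {1..length w}" for i
    using not_less_Least[of i "\<lambda>i. 1 \<le> i \<and> letters_le w i < i"] that assms(2)
    unfolding park_d_def letters_le_conv_card[symmetric] by auto
  then show ?thesis using assms(1) by (simp add: parking_iff)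
qed

lemma parking_park:
  assumes "is_word w"
  shows "parking (park w) \<and> length (park w) = length w \<and> columns_of (park w) = columns_of w"
  using assms
proof (induction w rule: park.induct)
  case (1 w)
  show ?case
  proof (cases "park_d w = length w + 1")
    case True
    then show ?thesis using 1(2) parking_if_park_d_eq_Suc_length by (simp add: park.simps[of w])
  next
    case False
    then show ?thesis
      using 1(1)[OF False] columns_of_park_step[OF 1(2)] by (simp add: park.simps[of w])
  qed
qed

section \<open>Orbits of the infinite symmetric group\<close>

lemma S_inf_bij: "\<sigma> \<in> S_inf \<Longrightarrow> bij \<sigma>"
proof (induction rule: S_inf.induct)
  case (step \<sigma> i)
  then show ?case by (intro bij_comp) auto
qed (rule bij_id)

lemma S_inf_comp: "\<sigma> \<in> S_inf \<Longrightarrow> \<tau> \<in> S_inf \<Longrightarrow> \<sigma> \<circ> \<tau> \<in> S_inf"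
  by (induction rule: S_inf.induct) (auto simp: comp_assoc intro: S_inf.step)

lemma transpose_in_S_inf: "Transposition.transpose a b \<in> S_inf"
proof -
  have adjacent: "Transposition.transpose i (Suc i) \<in> S_inf" for i
    using S_inf.step[OF S_inf.id, of i] by simp
  have less: "Transposition.transpose a b \<in> S_inf" if "a < b" for a b
    using that
  proof (induction b)
    case (Suc b)
    show ?case
    proof (cases "a = b")
      case False
      have "Transposition.transpose a (Suc b) = Transposition.transpose b (Suc b) \<circ>
          (Transposition.transpose a b \<circ> Transposition.transpose b (Suc b))"
        using False Suc.prems by (auto simp: fun_eq_iff transpose_def)
      moreover have "Transposition.transpose a b \<in> S_inf" using Suc False by simp
      ultimately show ?thesis using S_inf_comp adjacent by metis
    qed (simp add: adjacent)
  qed simp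
  show ?thesis
    using less[of a b] less[of b a] S_inf.id
    by (cases a b rule: linorder_cases) (auto simp: transpose_commute)
qed

lemma permutes_in_S_inf:
  assumes "\<sigma> permutes K" "finite K"
  shows "\<sigma> \<in> S_inf"
  using assms
  by (induction rule: permutes_induct) (rule S_inf.id, rule S_inf_comp[OF transpose_in_S_inf])

lemma ex_permutes_extending:
  assumes finite: "finite A" "finite B" and g: "bij_betw g A B"
  shows "\<exists>\<sigma>. \<sigma> permutes (A \<union> B) \<and> (\<forall>x\<in>A. \<sigma> x = g x)"
proof -
  have "card (B - A) = card (A - B)"
    using finite bij_betw_same_card[OF g]
      card_Un_disjoint[of A "B - A"] card_Un_disjoint[of B "A - B"]
    by (simp add: Un_commute)
  then obtain h where h: "bij_betw h (B - A) (A - B)"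
    using finite finite_same_card_bij[of "B - A" "A - B"] by auto
  define \<sigma> where "\<sigma> x = (if x \<in> A then g x else if x \<in> B then h x else x)" for x
  have "bij_betw \<sigma> (A \<union> (B - A)) (B \<union> (A - B))"
  proof (rule bij_betw_combine)
    show "bij_betw \<sigma> A B" using g by (rule bij_betw_cong[THEN iffD1, rotated]) (simp add: \<sigma>_def)
    show "bij_betw \<sigma> (B - A) (A - B)"
      using h by (rule bij_betw_cong[THEN iffD1, rotated]) (simp add: \<sigma>_def)
  qed blast
  then have "\<sigma> permutes (A \<union> B)"
    by (intro bij_imp_permutes) (auto simp: \<sigma>_def Un_commute)
  then show ?thesis by (auto simp: \<sigma>_def)
qed

lemma columns_eq_imp_reindex:
  assumes m: "m \<in> BW" and m': "m' \<in> BW" and columns_eq: "columns m = columns m'"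
  shows "\<exists>\<sigma>\<in>S_inf. m' = m \<circ> \<sigma>"
proof -
  define I where "I m = {j. fst (m j) \<noteq> {}}" for m :: biword
  have bij_I: "bij_betw m (I m) (columns m)" if "m \<in> BW" for m
    using BW_column_unique[OF that] by (auto simp: bij_betw_def columns_def I_def intro!: inj_onI)
  have finite_I: "finite (I m)" "finite (I m')"
    using finite_nonempty_columns m m' by (simp_all add: I_def)
  let ?g = "inv_into (I m) m \<circ> m'"
  have g: "bij_betw ?g (I m') (I m)"
    using bij_betw_trans[OF bij_I[OF m', folded columns_eq] bij_betw_inv_into[OF bij_I[OF m]]] .
  have m_inv_into: "m (?g j) = m' j" if "j \<in> I m'" for j
    using bij_betw_inv_into_right[OF bij_I[OF m]] bij_betwE[OF bij_I[OF m', folded columns_eq]] that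
    by simp
  obtain \<sigma> where \<sigma>: "\<sigma> permutes (I m' \<union> I m)" "\<And>j. j \<in> I m' \<Longrightarrow> \<sigma> j = ?g j"
    using ex_permutes_extending[OF finite_I(2,1) g] by blast
  have "m' j = m (\<sigma> j)" for j
  proof (cases "j \<in> I m'")
    case True
    then show ?thesis using m_inv_into \<sigma>(2) by simp
  next
    case False
    have "\<sigma> ` I m' = I m" using g \<sigma>(2) by (simp add: bij_betw_def)
    then have "\<sigma> j \<notin> I m" using False permutes_inj[OF \<sigma>(1)] by (metis inj_image_mem_iff)
    then show ?thesis
      using False BW_empty_column[OF m] BW_empty_column[OF m'] by (simp add: I_def)
  qed
  moreover have "\<sigma> \<in> S_inf" using permutes_in_S_inf[OF \<sigma>(1)] finite_I by simp
  ultimately show ?thesis by (intro bexI[of _ \<sigma>]) (auto simp: fun_eq_iff)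
qed

lemma word_act_inv:
  assumes "is_word w" "\<sigma> \<in> S_inf"
  shows "word_act (inv \<sigma>) w = Phi (biword_of w \<circ> \<sigma>)"
  using assms S_inf_bij[OF assms(2)]
  by (simp add: word_act_def the_inv_into_BW_Phi col_act_def inv_inv_eq)

lemma
  assumes w: "is_word w" and \<sigma>: "\<sigma> \<in> S_inf"
  shows is_word_word_act: "is_word (word_act (inv \<sigma>) w)"
    and length_word_act: "length (word_act (inv \<sigma>) w) = length w"
    and columns_of_word_act: "columns_of (word_act (inv \<sigma>) w) = columns_of w"
proof -
  have "inj \<sigma>" "range \<sigma> = UNIV" using S_inf_bij[OF \<sigma>] by (simp_all add: bij_def)
  note reindex = reindex_BW[OF biword_of_in_BW[OF w] this(1), unfolded this(2), simplified]
  show "is_word (word_act (inv \<sigma>) w)" "length (word_act (inv \<sigma>) w) = length w"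
    "columns_of (word_act (inv \<sigma>) w) = columns_of w"
    unfolding word_act_inv[OF w \<sigma>] columns_of_Phi[OF reindex(1)]
    using reindex is_word_Phi
    by (simp_all add: length_Phi biword_length_biword_of[OF w] columns_of_def)
qed

lemma columns_of_eq_imp_word_act:
  assumes "is_word w" "is_word w'" "columns_of w = columns_of w'"
  shows "\<exists>\<sigma>\<in>S_inf. w' = word_act (inv \<sigma>) w"
proof -
  obtain \<sigma> where "\<sigma> \<in> S_inf" "biword_of w' = biword_of w \<circ> \<sigma>"
    using columns_eq_imp_reindex[OF biword_of_in_BW biword_of_in_BW] assms
    unfolding columns_of_def by blast
  then show ?thesis using word_act_inv[OF assms(1)] Phi_biword_of[OF assms(2)] by metis
qed

section \<open>The sets of columns of words\<close>

definition prime_parking_words :: "nat set \<Rightarrow> nat list set" where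
  "prime_parking_words Q = {u. prime_parking u \<and> length u = card Q}"

lemma columns_in_assemblies:
  assumes m: "m \<in> BW"
  shows "columns m \<in> assemblies prime_parking_words {1..biword_length m}"
proof -
  have column_unique: "c = d" if "c \<in> columns m" "d \<in> columns m" "p \<in> fst c" "p \<in> fst d" for c d p
    using that BW_column_unique[OF m] unfolding columns_def by blast
  have "inj_on fst (columns m)"
  proof (rule inj_onI)
    fix c d assume "c \<in> columns m" "d \<in> columns m" "fst c = fst d"
    moreover then obtain p where "p \<in> fst c" by (auto simp: columns_def)
    ultimately show "c = d" using column_unique by metis
  qed
  moreover have "partition_on {1..biword_length m} (fst ` columns m)"
    unfolding partition_on_def
  proof (intro conjI)
    show "\<Union>(fst ` columns m) = {1..biword_length m}"
      unfolding BW_Union[OF m, symmetric] columns_def by auto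
    show "disjoint (fst ` columns m)" unfolding disjoint_def using column_unique by blast
  qed (auto simp: columns_def)
  moreover have "snd c \<in> prime_parking_words (fst c)" if "c \<in> columns m" for c
    using that prime_parking_BW[OF m] length_snd_BW[OF m]
    by (auto simp: columns_def prime_parking_words_def)
  ultimately show ?thesis by (auto simp: assemblies_def case_prod_beta)
qed

definition list_biword :: "(nat set \<times> nat list) list \<Rightarrow> biword" where
  "list_biword cs j = (if j < length cs then cs ! j else ({}, []))"

lemma columns_list_biword:
  assumes "\<And>c. c \<in> set cs \<Longrightarrow> fst c \<noteq> {}"
  shows "columns (list_biword cs) = set cs"
proof -
  have nonempty: "{j. fst (list_biword cs j) \<noteq> {}} = {..<length cs}"
    using assms by (auto simp: list_biword_def split: if_splits)
  have "columns (list_biword cs) = (!) cs ` {..<length cs}"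
    unfolding columns_def nonempty by (intro image_cong) (auto simp: list_biword_def)
  then show ?thesis by (auto simp: set_conv_nth)
qed

lemma
  assumes cs: "distinct cs" "set cs \<in> assemblies prime_parking_words {1..n}"
  shows list_biword_in_BW: "list_biword cs \<in> BW"
    and biword_length_list_biword: "biword_length (list_biword cs) = n"
    and columns_list_biword_assembly: "columns (list_biword cs) = set cs"
proof -
  have inj: "inj_on fst (set cs)" and partition: "partition_on {1..n} (fst ` set cs)"
    using cs(2) by (simp_all add: assemblies_def)
  have "fst c \<noteq> {}" if "c \<in> set cs" for c
    using partition_onD3[OF partition] that by (metis imageI)
  then show columns_eq: "columns (list_biword cs) = set cs" by (rule columns_list_biword)
  have "(\<Union>i. fst (list_biword cs i)) = \<Union>(fst ` columns (list_biword cs))"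
    by (auto simp: columns_def)
  then have Union_eq: "(\<Union>i. fst (list_biword cs i)) = {1..n}"
    using partition_onD1[OF partition] columns_eq by simp
  then show "biword_length (list_biword cs) = n" by (simp add: biword_length_def)
  have "fst (list_biword cs i) \<inter> fst (list_biword cs j) = {}" if "i \<noteq> j" for i j
  proof (cases "i < length cs \<and> j < length cs")
    case True
    then have "fst (cs ! i) \<noteq> fst (cs ! j)"
      using inj_onD[OF inj, of "cs ! i" "cs ! j"] that cs(1) by (auto simp: nth_eq_iff_index_eq)
    then show ?thesis
      using disjointD[OF partition_onD2[OF partition], of "fst (cs ! i)" "fst (cs ! j)"] True
      by (simp add: list_biword_def)
  qed (auto simp: list_biword_def)
  moreover have "prime_parking (snd (list_biword cs i)) \<and>
      length (snd (list_biword cs i)) = card (fst (list_biword cs i))" for i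
  proof (cases "i < length cs")
    case True
    then have "cs ! i \<in> set cs" by simp
    then show ?thesis
      using True cs(2)
      by (auto simp: assemblies_def prime_parking_words_def list_biword_def case_prod_beta)
  qed (simp add: list_biword_def)
  ultimately show "list_biword cs \<in> BW" using Union_eq by (auto simp: BW_def)
qed

lemma columns_of_image:
  "columns_of ` {w. is_word w \<and> length w = n} = assemblies prime_parking_words {1..n}"
proof
  show "columns_of ` {w. is_word w \<and> length w = n} \<subseteq> assemblies prime_parking_words {1..n}"
    using columns_in_assemblies[OF biword_of_in_BW]
    by (auto simp: columns_of_def biword_length_biword_of)
  show "assemblies prime_parking_words {1..n} \<subseteq> columns_of ` {w. is_word w \<and> length w = n}"
  proof
    fix C assume C: "C \<in> assemblies prime_parking_words {1..n}"
    then have "inj_on fst C" "partition_on {1..n} (fst ` C)" by (simp_all add: assemblies_def)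
    then have "finite C"
      using finite_elements[of "{1..n}" "fst ` C"] by (simp add: finite_image_iff)
    then obtain cs where cs: "set cs = C" "distinct cs" using finite_distinct_list by blast
    then have in_assemblies: "set cs \<in> assemblies prime_parking_words {1..n}" using C by simp
    note BW = list_biword_in_BW[OF cs(2) in_assemblies]
    have "columns_of (Phi (list_biword cs)) = C"
      using columns_list_biword_assembly[OF cs(2) in_assemblies] cs(1)
      by (simp add: columns_of_Phi BW)
    moreover have "is_word (Phi (list_biword cs))" by (rule is_word_Phi[OF BW])
    moreover have "length (Phi (list_biword cs)) = n"
      using biword_length_list_biword[OF cs(2) in_assemblies] by (simp add: length_Phi)
    ultimately show "C \<in> columns_of ` {w. is_word w \<and> length w = n}" by blast
  qed
qed

section \<open>The dimension of the invariants\<close>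

definition columns_indicator :: "nat \<Rightarrow> (nat set \<times> nat list) set \<Rightarrow> nat list \<Rightarrow> 'k::field_char_0" where
  "columns_indicator n C = (\<lambda>w. if is_word w \<and> length w = n \<and> columns_of w = C then 1 else 0)"

lemma sum_fun_apply: "(\<Sum>x\<in>A. f x) w = (\<Sum>x\<in>A. f x w)"
  by (induction A rule: infinite_finite_induct) auto

lemma columns_indicator_eq_sum_G:
  "columns_indicator n C
    = (\<Sum>u | parking u \<and> length u = n \<and> columns_of u = C. (G u :: nat list \<Rightarrow> 'k::field_char_0))"
proof
  fix w
  let ?U = "{u. parking u \<and> length u = n \<and> columns_of u = C}"
  have finite: "finite ?U" by (rule finite_subset[OF _ finite_parking[of n]]) auto
  show "(columns_indicator n C :: nat list \<Rightarrow> 'k) w = (\<Sum>u\<in>?U. G u) w"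
  proof (cases "is_word w")
    case True
    then have "park w \<in> ?U \<longleftrightarrow> length w = n \<and> columns_of w = C"
      using parking_park[OF True] by auto
    moreover have "(\<Sum>u\<in>?U. (G u :: nat list \<Rightarrow> 'k) w) = (if park w \<in> ?U then 1 else 0)"
      using True finite sum.delta[of ?U "park w" "\<lambda>_. 1 :: 'k"] by (simp add: G_def eq_commute)
    ultimately show ?thesis using True by (simp add: columns_indicator_def sum_fun_apply)
  next
    case False
    then show ?thesis by (simp add: columns_indicator_def sum_fun_apply G_def)
  qed
qed

lemma columns_indicator_in_PQSym_inf_comp:
  "(columns_indicator n C :: nat list \<Rightarrow> 'k::field_char_0) \<in> PQSym_inf_comp n"
proof -
  have "(columns_indicator n C :: nat list \<Rightarrow> 'k) \<in> PQSym_comp n"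
    unfolding columns_indicator_eq_sum_G PQSym_comp_def
    by (intro series.span_sum series.span_base) auto
  moreover have "PQSym_comp n \<subseteq> (PQSym :: (nat list \<Rightarrow> 'k) set)"
    unfolding PQSym_comp_def PQSym_def by (intro series.span_mono) auto
  moreover have "series_act \<sigma> (columns_indicator n C) = (columns_indicator n C :: nat list \<Rightarrow> 'k)"
    if \<sigma>: "\<sigma> \<in> S_inf" for \<sigma>
    using is_word_word_act[OF _ \<sigma>] length_word_act[OF _ \<sigma>] columns_of_word_act[OF _ \<sigma>]
    by (auto simp: series_act_def columns_indicator_def fun_eq_iff)
  ultimately show ?thesis by (auto simp: PQSym_inf_comp_def PQSym_inf_def)
qed

lemma PQSym_comp_eq_0:
  assumes "f \<in> PQSym_comp n" "\<not> (is_word w \<and> length w = n)"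
  shows "f w = (0 :: 'k::field_char_0)"
  using assms(1) unfolding PQSym_comp_def
proof (induction rule: series.span_induct_alt)
  case (step c g f)
  then obtain u where "g = G u" "length u = n" by auto
  then have "g w = 0" using assms(2) parking_park[of w] by (auto simp: G_def)
  then show ?case using step by (simp add: scale_series_def)
qed simp

lemma PQSym_inf_comp_columns_of_cong:
  assumes f: "f \<in> PQSym_inf_comp n" and w: "is_word w" "is_word w'" "columns_of w = columns_of w'"
  shows "f w = (f w' :: 'k::field_char_0)"
proof -
  obtain \<sigma> where \<sigma>: "\<sigma> \<in> S_inf" "w' = word_act (inv \<sigma>) w"
    using columns_of_eq_imp_word_act[OF w] by blast
  then have "series_act \<sigma> f = f" using f by (auto simp: PQSym_inf_comp_def PQSym_inf_def)
  then have "f w = series_act \<sigma> f w" by simp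
  then show ?thesis using w \<sigma> by (simp add: series_act_def)
qed

lemma series_dim_eq_card:
  fixes b :: "'i \<Rightarrow> nat list \<Rightarrow> 'k::field_char_0"
  assumes finite: "finite I" and subset: "b ` I \<subseteq> W"
    and dual: "\<And>i j. i \<in> I \<Longrightarrow> j \<in> I \<Longrightarrow> b i (x j) = (if i = j then 1 else 0)"
    and expand: "\<And>f. f \<in> W \<Longrightarrow> f = (\<Sum>i\<in>I. scale_series (f (x i)) (b i))"
  shows "series.dim W = card I"
proof (rule series.dim_unique)
  have inj: "inj_on b I" by (rule inj_onI) (metis dual zero_neq_one)
  show "b ` I \<subseteq> W" by (rule subset)
  show "W \<subseteq> series.span (b ` I)"
  proof
    fix f assume "f \<in> W"
    then have "f = (\<Sum>i\<in>I. scale_series (f (x i)) (b i))" by (rule expand)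
    also have "\<dots> \<in> series.span (b ` I)"
      by (intro series.span_sum series.span_scale series.span_base imageI)
    finally show "f \<in> series.span (b ` I)" .
  qed
  show "series.independent (b ` I)"
  proof (rule series.independent_if_scalars_zero)
    fix a f assume zero: "(\<Sum>g\<in>b ` I. scale_series (a g) g) = 0" and "f \<in> b ` I"
    then obtain i where i: "i \<in> I" "f = b i" by blast
    have "0 = (\<Sum>g\<in>b ` I. scale_series (a g) g) (x i)" by (simp add: zero)
    also have "\<dots> = (\<Sum>j\<in>I. a (b j) * b j (x i))"
      unfolding sum_fun_apply by (subst sum.reindex[OF inj]) (simp add: scale_series_def)
    also have "\<dots> = (\<Sum>j\<in>I. if j = i then a (b j) else 0)"
      using dual[OF _ i(1)] by (intro sum.cong) auto
    also have "\<dots> = a f" using finite i by simp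
    finally show "a f = 0" by simp
  qed (use finite in simp)
  show "card (b ` I) = card I" by (rule card_image[OF inj])
qed

lemma finite_prime_parking_words: "finite (prime_parking_words Q)"
  unfolding prime_parking_words_def by (rule finite_prime_parking)

lemma card_prime_parking_words:
  "finite Q \<Longrightarrow> Q \<noteq> {} \<Longrightarrow> card (prime_parking_words Q) = (card Q - 1) ^ (card Q - 1)"
  unfolding prime_parking_words_def by (rule card_prime_parking) (simp add: Suc_le_eq card_gt_0_iff)

lemma PQSym_inf_comp_expansion:
  fixes f :: "nat list \<Rightarrow> 'k::field_char_0"
  assumes f: "f \<in> PQSym_inf_comp n"
    and word: "\<And>C. C \<in> assemblies prime_parking_words {1..n} \<Longrightarrow>
      is_word (word C) \<and> length (word C) = n \<and> columns_of (word C) = C"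
  shows "f = (\<Sum>C\<in>assemblies prime_parking_words {1..n}.
    scale_series (f (word C)) (columns_indicator n C))" (is "f = ?expansion")
proof
  let ?A = "assemblies prime_parking_words {1..n}"
  fix w
  show "f w = ?expansion w"
  proof (cases "is_word w \<and> length w = n")
    case True
    then have columns: "columns_of w \<in> ?A" unfolding columns_of_image[symmetric] by blast
    have "?expansion w = (\<Sum>C\<in>?A. if columns_of w = C then f (word C) else 0)"
      unfolding sum_fun_apply using True
      by (intro sum.cong) (auto simp: scale_series_def columns_indicator_def)
    also have "\<dots> = f (word (columns_of w))"
      using columns finite_assemblies[OF _ finite_prime_parking_words, of "{1..n}"] by simp
    also have "\<dots> = f w" using PQSym_inf_comp_columns_of_cong[OF f] word[OF columns] True by blast
    finally show ?thesis by simp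
  next
    case False
    then have "f w = 0" using f PQSym_comp_eq_0 by (auto simp: PQSym_inf_comp_def)
    then show ?thesis
      using False by (auto simp: sum_fun_apply scale_series_def columns_indicator_def)
  qed
qed

lemma dim_PQSym_inf_comp:
  "series.dim (PQSym_inf_comp n :: (nat list \<Rightarrow> 'k::field_char_0) set)
    = card (assemblies prime_parking_words {1..n})"
proof -
  let ?A = "assemblies prime_parking_words {1..n}"
  have "\<forall>C\<in>?A. \<exists>w. is_word w \<and> length w = n \<and> columns_of w = C"
    unfolding columns_of_image[symmetric] by blast
  then obtain word where word:
    "\<And>C. C \<in> ?A \<Longrightarrow> is_word (word C) \<and> length (word C) = n \<and> columns_of (word C) = C"
    by metis
  show ?thesis
  proof (rule series_dim_eq_card)
    show "finite ?A" by (intro finite_assemblies finite_prime_parking_words) simp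
    show "columns_indicator n ` ?A \<subseteq> (PQSym_inf_comp n :: (nat list \<Rightarrow> 'k) set)"
      using columns_indicator_in_PQSym_inf_comp by blast
    show "columns_indicator n C (word C') = (if C = C' then 1 else 0 :: 'k)" if "C' \<in> ?A" for C C'
      using word[OF that] by (auto simp: columns_indicator_def)
    show "f = (\<Sum>C\<in>?A. scale_series (f (word C)) (columns_indicator n C))"
      if "f \<in> PQSym_inf_comp n" for f :: "nat list \<Rightarrow> 'k"
      using that word by (rule PQSym_inf_comp_expansion)
  qed
qed

theorem mainTheorem4:
  fixes n :: nat
  assumes "n \<ge> 1"
  shows "series.dim (PQSym_inf_comp n :: (nat list \<Rightarrow> 'k::field_char_0) set) = (\<Sum>k=1..n. A_inf n k)
    \<and> (\<Sum>k=1..n. A_inf n k) = card (chain_trees n)"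
proof
  have "series.dim (PQSym_inf_comp n :: (nat list \<Rightarrow> 'k) set)
      = card (assemblies prime_parking_words {1..n})"
    by (rule dim_PQSym_inf_comp)
  also have "\<dots> = (\<Sum>k=1..n. A_inf n k)"
    using assms finite_prime_parking_words card_prime_parking_words
    by (rule card_assemblies_eq_sum_A_inf)
  finally show "series.dim (PQSym_inf_comp n :: (nat list \<Rightarrow> 'k) set) = (\<Sum>k=1..n. A_inf n k)" .
  show "(\<Sum>k=1..n. A_inf n k) = card (chain_trees n)"
    by (rule card_chain_trees[OF assms, symmetric])
qed

end
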